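(* Assume: ($H_1'$) the system $\frac{d}{dt}y=Ay+Bu$ is smoothly controllable in time $T_0$ for some $T_0>0$; ($H_2'$) $\mathscr{U}_{ad}\subset U$ is closed and convex and $\mathrm{int}^V(\mathscr{U}_{ad}\cap V)\neq\varnothing$, where $\mathrm{int}^V$ denotes the interior in the topology of $V$; ($H_3'$) $A$ generates a $C_0$-group $\{\mathbb{T}_t\}_{t\in\mathbb{R}}$ on $H$ with $\|\mathbb{T}_t\|_{\mathscr{L}(H,H)}=1$ for all $t\in\mathbb{R}$, and $A$ is invertible from $D(A)$ to $H$ with continuous inverse. For $i=0,1$, let $\overline{y}_i\in C^s(\mathbb{R};H)$ be a solution of $\frac{d}{dt}\overline{y}_i(t)=A\overline{y}_i(t)+B\overline{u}^i(t)$, $t\in\mathbb{R}$, with control $\overline{u}^i\in L^2_{loc}(\mathbb{R};U)$ such that $\overline{u}^i(t)\in\mathscr{U}_{ad}$ for a.e. $t\in\mathbb{R}$. Let $\tau_0,\tau_1\in\mathbb{R}$. Then there exist $T>0$ and $u\in L^2(0,T;U)$ such that $y(T;\overline{y}_0(\tau_0),u)=\overline{y}_1(\tau_1)$ and $u(t)\in\mathscr{U}_{ad}$ for a.e. $t\in(0,T)$.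
   Context: Abstract setting. $H$ (state space) and $U$ (control space) are real Hilbert spaces. $A:D(A)\subset H\to H$ generates a $C_0$-semigroup $(\mathbb{T}_t)_{t\ge0}$ on $H$. $H_{-1}$ is the completion of $H$ for the norm $\|(\beta I-A)^{-1}\cdot\|_H$, where $\beta$ is real and $\beta I-A$ is invertible with continuous inverse on $H$ (the space does not depend on $\beta$); $A$ extends uniquely to a bounded operator $H\to H_{-1}$, still denoted $A$, and the semigroup extends to $H_{-1}$. The control operator $B\in\mathscr{L}(U,H_{-1})$ is assumed admissible: for all $\tau>0$ and all $u\in L^2((0,+\infty);U)$, $\int_0^\tau\mathbb{T}_{\tau-r}Bu(r)\,dr\in H$. For $y_0\in H$ and $u\in L^2_{loc}([0,+\infty);U)$, $y(\cdot;y_0,u)\in C^0([0,+\infty);H)$ denotes the unique mild solution of $\frac{d}{dt}y(t)=Ay(t)+Bu(t)$, $y(0)=y_0$, namely $y(t)=\mathbb{T}_ty_0+\int_0^t\mathbb{T}_{t-r}Bu(r)\,dr$ (for controls defined on $(0,T)$ only, the solution is considered on $[0,T]$). Solutions on $\mathbb{R}$ are mild solutions: $\overline{y}(t)=\mathbb{T}_{t-t_0}\overline{y}(t_0)+\int_{t_0}^t\mathbb{T}_{t-r}B\overline{u}(r)\,dr$ for all $t_0\le t$. Fix $s\in\mathbb{N}$ and a Hilbert space $V$ continuously embedded in $U$. $D(A^s)$ carries the norm $\|x\|_{D(A^s)}^2=\sum_{j=0}^s\|A^jx\|_H^2$. Smooth controllability: the system is smoothly controllable in time $T_0>0$ if there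 is a constant $C$ such that for every $y_0\in D(A^s)$ there exists $v\in L^\infty((0,T_0);V)$ with $y(T_0;y_0,v)=0$ and $\|v\|_{L^\infty((0,T_0);V)}\le C\|y_0\|_{D(A^s)}$, $C$ being independent of $y_0$. *)

theory Defs
  imports "HOL-Analysis.Analysis"
begin

text \<open>
  Unbounded operators are pairs of a domain \<open>D\<close> and a total function \<open>A\<close> whose values outside
  \<open>D\<close> are irrelevant.  A subspace inclusion (\<open>H\<close> in \<open>H\<^sub>-\<^sub>1\<close>, \<open>V\<close> in \<open>U\<close>) is an injective
  linear map between types.
\<close>

subsection \<open>Semigroups and groups of operators\<close>

definition C0_semigroup :: "(real \<Rightarrow> 'h \<Rightarrow> 'h::real_normed_vector) \<Rightarrow> bool" where
  "C0_semigroup T \<longleftrightarrow>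
     (\<forall>t\<ge>0. bounded_linear (T t)) \<and>
     (\<forall>x. T 0 x = x) \<and>
     (\<forall>s\<ge>0. \<forall>t\<ge>0. \<forall>x. T (s + t) x = T s (T t x)) \<and>
     (\<forall>x. ((\<lambda>t. T t x) \<longlongrightarrow> x) (at_right 0))"

definition generates_C0_semigroup ::
    "'h set \<Rightarrow> ('h \<Rightarrow> 'h) \<Rightarrow> (real \<Rightarrow> 'h \<Rightarrow> 'h::real_normed_vector) \<Rightarrow> bool" where
  "generates_C0_semigroup D A T \<longleftrightarrow>
     C0_semigroup T \<and>
     D = {x. \<exists>y. ((\<lambda>t. (T t x - x) /\<^sub>R t) \<longlongrightarrow> y) (at_right 0)} \<and>
     (\<forall>x\<in>D. ((\<lambda>t. (T t x - x) /\<^sub>R t) \<longlongrightarrow> A x) (at_right 0))"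

definition C0_group :: "(real \<Rightarrow> 'h \<Rightarrow> 'h::real_normed_vector) \<Rightarrow> bool" where
  "C0_group T \<longleftrightarrow>
     (\<forall>t. bounded_linear (T t)) \<and>
     (\<forall>x. T 0 x = x) \<and>
     (\<forall>s t x. T (s + t) x = T s (T t x)) \<and>
     (\<forall>x. ((\<lambda>t. T t x) \<longlongrightarrow> x) (at 0))"

definition generates_C0_group ::
    "'h set \<Rightarrow> ('h \<Rightarrow> 'h) \<Rightarrow> (real \<Rightarrow> 'h \<Rightarrow> 'h::real_normed_vector) \<Rightarrow> bool" where
  "generates_C0_group D A T \<longleftrightarrow>
     C0_group T \<and>
     D = {x. \<exists>y. ((\<lambda>t. (T t x - x) /\<^sub>R t) \<longlongrightarrow> y) (at 0)} \<and>
     (\<forall>x\<in>D. ((\<lambda>t. (T t x - x) /\<^sub>R t) \<longlongrightarrow> A x) (at 0))"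

definition boundedly_invertible_on :: "'h set \<Rightarrow> ('h \<Rightarrow> 'h::real_normed_vector) \<Rightarrow> bool" where
  "boundedly_invertible_on D F \<longleftrightarrow> bij_betw F D UNIV \<and> bounded_linear (inv_into D F)"

text \<open>\<open>D(A\<^sup>s)\<close> and its norm\<close>

primrec dom_pow :: "'h set \<Rightarrow> ('h \<Rightarrow> 'h) \<Rightarrow> nat \<Rightarrow> 'h set" where
  "dom_pow D A 0 = UNIV"
| "dom_pow D A (Suc n) = {x \<in> D. A x \<in> dom_pow D A n}"

definition dom_pow_norm :: "('h \<Rightarrow> 'h) \<Rightarrow> nat \<Rightarrow> 'h::real_normed_vector \<Rightarrow> real" where
  "dom_pow_norm A s x = sqrt (\<Sum>j\<le>s. (norm ((A ^^ j) x))\<^sup>2)"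

subsection \<open>The extrapolation space\<close>

text \<open>
  The Banach space \<open>'k\<close> with the embedding \<open>\<iota>\<close> is a completion of \<open>H\<close> for the norm
  \<open>\<parallel>(\<beta>I - A)\<^sup>-\<^sup>1 x\<parallel>\<close>; completeness is part of the type class, and completions are unique up to
  a unique isometry.  Injectivity of \<open>\<iota>\<close> follows from the norm identity.
\<close>

definition extrapolation_space ::
    "'h::real_normed_vector set \<Rightarrow> ('h \<Rightarrow> 'h) \<Rightarrow> real \<Rightarrow> ('h \<Rightarrow> 'k::banach) \<Rightarrow> bool" where
  "extrapolation_space D A \<beta> \<iota> \<longleftrightarrow>
     boundedly_invertible_on D (\<lambda>x. \<beta> *\<^sub>R x - A x) \<and>
     linear \<iota> \<and>
     (\<forall>x. norm (\<iota> x) = norm (inv_into D (\<lambda>x. \<beta> *\<^sub>R x - A x) x)) \<and>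
     closure (range \<iota>) = UNIV"

text \<open>
  The bounded extension of \<open>S\<close> from \<open>H\<close> to \<open>H\<^sub>-\<^sub>1\<close>: unique because \<open>\<iota>\<close> has dense range, and it exists
  for \<open>S = T\<^sub>t\<close> because \<open>T\<^sub>t\<close> commutes with \<open>(\<beta>I - A)\<^sup>-\<^sup>1\<close>.
\<close>

definition extend_op ::
    "('h \<Rightarrow> 'k::real_normed_vector) \<Rightarrow> ('h \<Rightarrow> 'h) \<Rightarrow> 'k \<Rightarrow> 'k" where
  "extend_op \<iota> S = (THE S'. bounded_linear S' \<and> (\<forall>x. S' (\<iota> x) = \<iota> (S x)))"

subsection \<open>Function spaces\<close>

text \<open>
  The spaces are not assumed separable, so measurability is strong (Bochner) measurability, i.e.
  being an almost everywhere limit of simple functions.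
\<close>

definition strongly_measurable_on :: "real set \<Rightarrow> (real \<Rightarrow> 'u::real_normed_vector) \<Rightarrow> bool" where
  "strongly_measurable_on S u \<longleftrightarrow>
     (\<exists>f. (\<forall>n::nat. simple_function (lebesgue_on S) (f n)) \<and>
          (AE r in lebesgue_on S. (\<lambda>n. f n r) \<longlonglongrightarrow> u r))"

definition L2_on :: "real set \<Rightarrow> (real \<Rightarrow> 'u::real_normed_vector) \<Rightarrow> bool" where
  "L2_on S u \<longleftrightarrow>
     strongly_measurable_on S u \<and> integrable (lebesgue_on S) (\<lambda>r. (norm (u r))\<^sup>2)"

definition L2_loc :: "(real \<Rightarrow> 'u::real_normed_vector) \<Rightarrow> bool" where
  "L2_loc u \<longleftrightarrow> (\<forall>a b. L2_on {a..b} u)"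

definition Linf_on :: "real set \<Rightarrow> (real \<Rightarrow> 'u::real_normed_vector) \<Rightarrow> bool" where
  "Linf_on S u \<longleftrightarrow>
     strongly_measurable_on S u \<and> (\<exists>c. AE r in lebesgue_on S. norm (u r) \<le> c)"

definition Linf_norm :: "real set \<Rightarrow> (real \<Rightarrow> 'u::real_normed_vector) \<Rightarrow> real" where
  "Linf_norm S u = Inf {c. 0 \<le> c \<and> (AE r in lebesgue_on S. norm (u r) \<le> c)}"

primrec Ck_on_reals :: "nat \<Rightarrow> (real \<Rightarrow> 'h::real_normed_vector) \<Rightarrow> bool" where
  "Ck_on_reals 0 f \<longleftrightarrow> continuous_on UNIV f"
| "Ck_on_reals (Suc n) f \<longleftrightarrow>
     (\<exists>f'. (\<forall>t. (f has_vector_derivative f' t) (at t)) \<and> Ck_on_reals n f')"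

subsection \<open>The control system\<close>

text \<open>
  \<open>\<integral>\<^sub>a\<^sup>b T\<^sub>b\<^sub>-\<^sub>r B u(r) dr\<close> in \<open>H\<^sub>-\<^sub>1\<close>.  For a locally square integrable \<open>u\<close> the integrand is Bochner
  integrable; the Bochner integral is written as a Henstock-Kurzweil integral, which coincides
  with it on Bochner integrable functions and is available without separability.
\<close>

definition input_integral ::
    "('h \<Rightarrow> 'k::banach) \<Rightarrow> (real \<Rightarrow> 'h \<Rightarrow> 'h) \<Rightarrow> ('u \<Rightarrow> 'k) \<Rightarrow> (real \<Rightarrow> 'u) \<Rightarrow> real \<Rightarrow> real \<Rightarrow> 'k" where
  "input_integral \<iota> T B u a b = integral {a..b} (\<lambda>r. extend_op \<iota> (T (b - r)) (B (u r)))"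

definition admissible_control_operator ::
    "('h \<Rightarrow> 'k::banach) \<Rightarrow> (real \<Rightarrow> 'h \<Rightarrow> 'h) \<Rightarrow> ('u::real_normed_vector \<Rightarrow> 'k) \<Rightarrow> bool" where
  "admissible_control_operator \<iota> T B \<longleftrightarrow>
     (\<forall>\<tau>>0. \<forall>u. L2_on {0<..} u \<longrightarrow> input_integral \<iota> T B u 0 \<tau> \<in> range \<iota>)"

text \<open>The state \<open>y(t; y\<^sub>0, u)\<close>, where the integral is read as an element of \<open>H\<close>.\<close>

definition mild_solution ::
    "('h::real_normed_vector \<Rightarrow> 'k::banach) \<Rightarrow> (real \<Rightarrow> 'h \<Rightarrow> 'h) \<Rightarrow> ('u \<Rightarrow> 'k) \<Rightarrow>
     'h \<Rightarrow> (real \<Rightarrow> 'u) \<Rightarrow> real \<Rightarrow> 'h" where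
  "mild_solution \<iota> T B y\<^sub>0 u t = T t y\<^sub>0 + inv \<iota> (input_integral \<iota> T B u 0 t)"

definition mild_solution_on_reals ::
    "('h \<Rightarrow> 'k::banach) \<Rightarrow> (real \<Rightarrow> 'h \<Rightarrow> 'h) \<Rightarrow> ('u \<Rightarrow> 'k) \<Rightarrow>
     (real \<Rightarrow> 'u) \<Rightarrow> (real \<Rightarrow> 'h) \<Rightarrow> bool" where
  "mild_solution_on_reals \<iota> T B u y \<longleftrightarrow>
     (\<forall>t\<^sub>0 t. t\<^sub>0 \<le> t \<longrightarrow> \<iota> (y t) = \<iota> (T (t - t\<^sub>0) (y t\<^sub>0)) + input_integral \<iota> T B u t\<^sub>0 t)"

text \<open>\<open>j\<close> is the embedding of \<open>V\<close> into \<open>U\<close>.\<close>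

definition smoothly_controllable ::
    "'h::real_normed_vector set \<Rightarrow> ('h \<Rightarrow> 'h) \<Rightarrow> ('h \<Rightarrow> 'k::banach) \<Rightarrow> (real \<Rightarrow> 'h \<Rightarrow> 'h) \<Rightarrow> ('u \<Rightarrow> 'k) \<Rightarrow>
     ('v::real_normed_vector \<Rightarrow> 'u) \<Rightarrow> nat \<Rightarrow> real \<Rightarrow> bool" where
  "smoothly_controllable D A \<iota> T B j s T\<^sub>0 \<longleftrightarrow>
     (\<exists>C. \<forall>y\<^sub>0 \<in> dom_pow D A s. \<exists>v.
        Linf_on {0<..<T\<^sub>0} v \<and>
        mild_solution \<iota> T B y\<^sub>0 (\<lambda>t. j (v t)) T\<^sub>0 = 0 \<and>
        Linf_norm {0<..<T\<^sub>0} v \<le> C * dom_pow_norm A s y\<^sub>0)"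

end

theory Submission
  imports Defs
begin

text \<open>
  A point \<open>v\<^sub>0\<close> of the interior of \<open>j -` U\<^sub>a\<^sub>d\<close> gives a constant control \<open>\<sigma> = j v\<^sub>0\<close> that may be
  perturbed by \<open>j v\<close> with \<open>v\<close> small in \<open>V\<close>. Since \<open>A\<close> is invertible, this control has a steady state
  \<open>z = - A\<^sup>-\<^sup>1 B \<sigma>\<close>, which belongs to \<open>H\<close> because \<open>A\<^sup>-\<^sup>1\<close> extends to a bounded operator from the
  extrapolation space to \<open>H\<close>. The given state is steered to the target through the neighbourhood of
  \<open>z\<close>:

  \<^item> from \<open>ybar 0 \<tau>\<^sub>0\<close> to some \<open>z + a\<close> in time \<open>1\<close>,
  \<^item> from \<open>z + a\<close> to some \<open>z + b\<close> in a long time,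
  \<^item> from \<open>z + b\<close> to \<open>ybar 1 \<tau>\<^sub>1\<close> in time \<open>1\<close>,

  where \<open>a\<close> and \<open>b\<close> lie in \<open>D(A\<^sup>s)\<close>.

  The middle part uses smooth controllability and the isometry of the group. The free evolution
  commutes with \<open>A\<close>, so it preserves the norm of \<open>D(A\<^sup>s)\<close>; a deviation in \<open>D(A\<^sup>s)\<close> can therefore be
  removed in \<open>N\<close> equal parts, each of norm \<open>1/N\<close> times the original one at whatever time it is
  treated. For large \<open>N\<close> each part costs a control that is small in \<open>V\<close>, and \<open>\<sigma>\<close> plus that control
  stays in \<open>U\<^sub>a\<^sub>d\<close> (\<open>smooth_control_step\<close>, \<open>steers_around_steady_state\<close>).

  The two outer parts must produce deviations in \<open>D(A\<^sup>s)\<close>, although for an input operator that does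
  not map into \<open>H\<close> neither \<open>ybar i t\<close> nor \<open>z\<close> need lie in that space. The control is the convex
  combination \<open>\<sigma> + \<eta> (ubar i - \<sigma>)\<close> with a cutoff \<open>\<eta>\<close> between \<open>0\<close> and \<open>1\<close>. With \<open>f = ybar i - z\<close>,
  integration by parts against \<open>\<eta>\<close> replaces the singular input by \<open>\<integral> T (1 - r) (\<eta>' r f r) dr\<close>, an
  integral in \<open>H\<close> (\<open>cutoff_input\<close>). Here \<open>f\<close> is of class \<open>C\<^sup>s\<close> and \<open>\<eta>'\<close> is a multiple of
  \<open>(r (1 - r))\<^sup>s\<close>, hence vanishes to order \<open>s\<close> at both ends, so that \<open>s\<close> further integrations by
  parts show that this integral lies in \<open>D(A\<^sup>s)\<close> (\<open>smoothing_in_dom_pow\<close>).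

  The integrals are Henstock-Kurzweil integrals with values in arbitrary Banach spaces. The first
  two parts below provide what this requires: integrability of \<open>r \<mapsto> W r (u r)\<close> for a strongly
  continuous family \<open>W\<close> and a strongly measurable \<open>u\<close> with integrable norm, and the integration by
  parts formula against a merely integrable function.
\<close>

section \<open>Strongly measurable and square integrable functions\<close>

lemma AE_lebesgue_on_iff_negligible:
  assumes "S \<in> sets lebesgue"
  shows "(AE r in lebesgue_on S. P r) \<longleftrightarrow> (\<exists>N. negligible N \<and> (\<forall>r\<in>S - N. P r))"
proof -
  have "(AE r in lebesgue_on S. P r) \<longleftrightarrow> (AE r in lebesgue. r \<in> S \<longrightarrow> P r)"
    using assms by (simp add: AE_restrict_space_iff)
  also have "\<dots> \<longleftrightarrow> (\<exists>N. negligible N \<and> (\<forall>r\<in>S - N. P r))"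
  proof
    assume "AE r in lebesgue. r \<in> S \<longrightarrow> P r"
    then obtain N where "N \<in> null_sets lebesgue" "{r. \<not> (r \<in> S \<longrightarrow> P r)} \<subseteq> N"
      by (auto elim: AE_E3 simp: eventually_ae_filter)
    then show "\<exists>N. negligible N \<and> (\<forall>r\<in>S - N. P r)"
      by (intro exI[of _ N]) (auto simp: negligible_iff_null_sets)
  next
    assume "\<exists>N. negligible N \<and> (\<forall>r\<in>S - N. P r)"
    then obtain N where "N \<in> null_sets lebesgue" "\<forall>r\<in>S - N. P r"
      unfolding negligible_iff_null_sets by (elim exE conjE) (rule that)
    then show "AE r in lebesgue. r \<in> S \<longrightarrow> P r"
      by (intro AE_I'[of N]) auto
  qed
  finally show ?thesis .
qed

lemma AE_lebesgue_onE:
  assumes "S \<in> sets lebesgue" and "AE r in lebesgue_on S. P r"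
  obtains N where "negligible N" "\<forall>r\<in>S - N. P r"
proof -
  have "\<exists>N. negligible N \<and> (\<forall>r\<in>S - N. P r)"
    using assms(2) unfolding AE_lebesgue_on_iff_negligible[OF assms(1)] .
  then show thesis by (elim exE conjE) (rule that)
qed

lemma AE_lebesgue_onI:
  assumes "S \<in> sets lebesgue" "negligible N" "\<And>r. r \<in> S \<Longrightarrow> r \<notin> N \<Longrightarrow> P r"
  shows "AE r in lebesgue_on S. P r"
proof -
  have "\<exists>N. negligible N \<and> (\<forall>r\<in>S - N. P r)"
    using assms by (intro exI[of _ N]) simp
  then show ?thesis
    by (simp only: AE_lebesgue_on_iff_negligible[OF assms(1)])
qed

lemma AE_lebesgue_on_subset:
  assumes "S \<in> sets lebesgue" "S' \<in> sets lebesgue" "S \<subseteq> S'" "AE r in lebesgue_on S'. P r"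
  shows "AE r in lebesgue_on S. P r"
proof (rule AE_lebesgue_onE[OF assms(2,4)])
  fix N assume "negligible N" "\<forall>r\<in>S' - N. P r"
  then show ?thesis using assms(3) by (intro AE_lebesgue_onI[OF assms(1), of N]) auto
qed

lemma AE_lebesgue_on_Un:
  assumes "S \<in> sets lebesgue" "S' \<in> sets lebesgue"
    "AE r in lebesgue_on S. P r" "AE r in lebesgue_on S'. P r"
  shows "AE r in lebesgue_on (S \<union> S'). P r"
proof (rule AE_lebesgue_onE[OF assms(1,3)], rule AE_lebesgue_onE[OF assms(2,4)])
  fix N N' assume "negligible N" "\<forall>r\<in>S - N. P r" "negligible N'" "\<forall>r\<in>S' - N'. P r"
  then show ?thesis
    using assms(1,2) by (intro AE_lebesgue_onI[of _ "N \<union> N'"]) auto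
qed

lemma AE_lebesgue_on_shift:
  fixes a b c :: real
  assumes "AE r in lebesgue_on {a..b}. P r"
  shows "AE r in lebesgue_on {a+c..b+c}. P (r - c)"
proof (rule AE_lebesgue_onE[OF _ assms])
  fix N assume N: "negligible N" "\<forall>r\<in>{a..b} - N. P r"
  have "negligible ((+) c ` N)" using N(1) by (rule negligible_translation)
  then show ?thesis
  proof (rule AE_lebesgue_onI[rotated])
    fix r assume r: "r \<in> {a+c..b+c}" "r \<notin> (+) c ` N"
    then have "r - c \<notin> N" by (metis add.commute diff_add_cancel image_eqI)
    then show "P (r - c)" using N(2) r(1) by auto
  qed simp
qed simp

text \<open>
  Values may lie in a space without a useful \<open>\<sigma>\<close>-algebra, so simple functions are handled through
  their level sets, as subsets of the real line.
\<close>

lemma simple_function_lebesgue_on_iff: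
  assumes "S \<in> sets lebesgue"
  shows "simple_function (lebesgue_on S) f \<longleftrightarrow>
    finite (f ` S) \<and> (\<forall>x\<in>f ` S. {r \<in> S. f r = x} \<in> sets lebesgue)"
proof -
  have "f -` {x} \<inter> S = {r \<in> S. f r = x}" for x by auto
  then show ?thesis
    using assms by (auto simp: simple_function_def sets_restrict_space_iff)
qed

lemma simple_function_levelset_measurable:
  assumes "S \<in> sets lebesgue" "simple_function (lebesgue_on S) f"
  shows "{r \<in> S. f r = x} \<in> sets lebesgue"
proof (cases "x \<in> f ` S")
  case True
  then show ?thesis using assms(2) unfolding simple_function_lebesgue_on_iff[OF assms(1)] by (metis (no_types))
next
  case False
  then have "{r \<in> S. f r = x} = {}" by auto
  then show ?thesis by (metis (no_types) sets.empty_sets)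
qed

lemma strongly_measurable_onE:
  assumes "strongly_measurable_on S u"
  obtains f where "\<And>n::nat. simple_function (lebesgue_on S) (f n)"
    and "AE r in lebesgue_on S. (\<lambda>n. f n r) \<longlonglongrightarrow> u r"
proof -
  from assms obtain f where "(\<forall>n::nat. simple_function (lebesgue_on S) (f n)) \<and>
          (AE r in lebesgue_on S. (\<lambda>n. f n r) \<longlonglongrightarrow> u r)"
    unfolding strongly_measurable_on_def ..
  then show thesis by (intro that[of f]) simp_all
qed

lemma strongly_measurable_onI:
  assumes "\<And>n::nat. simple_function (lebesgue_on S) (f n)"
    and "AE r in lebesgue_on S. (\<lambda>n. f n r) \<longlonglongrightarrow> u r"
  shows "strongly_measurable_on S u"
  unfolding strongly_measurable_on_def using assms by (intro exI[of _ f] conjI allI)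

lemma strongly_measurable_compose2:
  assumes u: "strongly_measurable_on S u" and v: "strongly_measurable_on S v"
    and g: "continuous_on UNIV (\<lambda>p. g (fst p) (snd p))"
  shows "strongly_measurable_on S (\<lambda>r. g (u r) (v r))"
proof -
  obtain f h where f: "\<And>n::nat. simple_function (lebesgue_on S) (f n)"
    and fl: "AE r in lebesgue_on S. (\<lambda>n. f n r) \<longlonglongrightarrow> u r"
    by (rule strongly_measurable_onE[OF u]) (rule that)
  obtain h where h: "\<And>n::nat. simple_function (lebesgue_on S) (h n)"
    and hl: "AE r in lebesgue_on S. (\<lambda>n. h n r) \<longlonglongrightarrow> v r"
    by (rule strongly_measurable_onE[OF v]) (rule that)
  have "AE r in lebesgue_on S. (\<lambda>n. g (f n r) (h n r)) \<longlonglongrightarrow> g (u r) (v r)"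
    using fl hl
  proof eventually_elim
    case (elim r)
    have "(\<lambda>n. (f n r, h n r)) \<longlonglongrightarrow> (u r, v r)"
      using elim by (intro tendsto_Pair)
    from continuous_on_tendsto_compose[OF g this] show ?case by simp
  qed
  moreover have "simple_function (lebesgue_on S) (\<lambda>r. g (f n r) (h n r))" for n
    using simple_function_compose2[OF f[of n] h[of n], of g] .
  ultimately show ?thesis
    by (intro strongly_measurable_onI[of S "\<lambda>n r. g (f n r) (h n r)"])
qed

lemma strongly_measurable_const: "strongly_measurable_on S (\<lambda>_. c)"
  by (rule strongly_measurable_onI[of S "\<lambda>_ _. c"]) simp_all

lemma strongly_measurable_compose:
  assumes "strongly_measurable_on S u" "continuous_on UNIV g"
  shows "strongly_measurable_on S (\<lambda>r. g (u r))"
proof -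
  have "continuous_on UNIV (\<lambda>p::'a \<times> real. g (fst p))"
    by (rule continuous_on_compose2[OF assms(2)]) (simp_all add: continuous_on_fst)
  then show ?thesis
    using strongly_measurable_compose2[OF assms(1) strongly_measurable_const[of S "0::real"], of "\<lambda>x _. g x"]
    by simp
qed

text \<open>
  The norms of the approximating simple functions are real measurable functions, and completeness
  of Lebesgue measure makes their almost everywhere limit measurable.
\<close>

lemma strongly_measurable_imp_norm_measurable:
  assumes "strongly_measurable_on S u" and "S \<in> sets lebesgue"
  shows "(\<lambda>r. norm (u r)) \<in> borel_measurable (lebesgue_on S)"
proof -
  obtain f where f: "\<And>n::nat. simple_function (lebesgue_on S) (f n)"
    and fl: "AE r in lebesgue_on S. (\<lambda>n. f n r) \<longlonglongrightarrow> u r"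
    by (rule strongly_measurable_onE[OF assms(1)]) (rule that)
  obtain N where N: "negligible N" "\<And>r. r \<in> S - N \<Longrightarrow> (\<lambda>n. f n r) \<longlonglongrightarrow> u r"
    using AE_lebesgue_onE[OF assms(2) fl] by (metis Diff_iff)
  have Nl: "N \<in> sets lebesgue" using N(1) negligible_imp_sets by blast
  define f' where "f' n r = (if r \<in> S - N then f n r else 0)" for n r
  define u' where "u' r = (if r \<in> S - N then u r else 0)" for r
  have meas: "(\<lambda>r. norm (f' n r)) \<in> borel_measurable lebesgue" for n
  proof -
    have "(\<lambda>r. norm (f n r)) \<in> borel_measurable (lebesgue_on S)"
      using simple_function_compose1[OF f[of n], of norm] by (rule borel_measurable_simple_function)
    then have "(\<lambda>r. if r \<in> S then norm (f n r) else 0) \<in> borel_measurable lebesgue"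
      using borel_measurable_if[OF assms(2)] by (rule iffD2[rotated])
    then have "(\<lambda>r. indicat_real (- N) r * (if r \<in> S then norm (f n r) else 0)) \<in> borel_measurable lebesgue"
      using Nl sets.compl_sets[of N lebesgue]
      by (intro borel_measurable_times borel_measurable_indicator) (simp_all add: Compl_eq_Diff_UNIV)
    also have "(\<lambda>r. indicat_real (- N) r * (if r \<in> S then norm (f n r) else 0)) = (\<lambda>r. norm (f' n r))"
      by (auto simp: f'_def indicator_def fun_eq_iff)
    finally show ?thesis .
  qed
  have "(\<lambda>n. norm (f' n r)) \<longlonglongrightarrow> norm (u' r)" for r
    using N(2)[of r] by (auto simp: f'_def u'_def intro!: tendsto_norm)
  then have "(\<lambda>r. norm (u' r)) \<in> borel_measurable lebesgue"
    by (rule borel_measurable_LIMSEQ_real) (auto intro: meas)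
  then have "(\<lambda>r. if r \<in> S then norm (u r) else 0) \<in> borel_measurable lebesgue"
  proof (rule borel_measurable_AE)
    show "AE r in lebesgue. norm (u' r) = (if r \<in> S then norm (u r) else 0)"
      using N(1) by (auto simp: eventually_ae_filter negligible_iff_null_sets u'_def intro!: bexI[of _ N])
  qed
  then show ?thesis
    using borel_measurable_if[OF assms(2)] by blast
qed

lemma strongly_measurable_on_subset:
  assumes S: "S \<in> sets lebesgue" "S' \<in> sets lebesgue" "S \<subseteq> S'"
    and u: "strongly_measurable_on S' u"
  shows "strongly_measurable_on S u"
proof (rule strongly_measurable_onE[OF u])
  fix f assume f: "\<And>n::nat. simple_function (lebesgue_on S') (f n)"
    and fl: "AE r in lebesgue_on S'. (\<lambda>n. f n r) \<longlonglongrightarrow> u r"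
  have "simple_function (lebesgue_on S) (f n)" for n
    unfolding simple_function_lebesgue_on_iff[OF S(1)]
  proof (intro conjI ballI)
    show "finite (f n ` S)"
      using f[of n] S by (auto simp: simple_function_lebesgue_on_iff intro: finite_subset[OF image_mono])
    fix x
    have "{r \<in> S. f n r = x} = {r \<in> S'. f n r = x} \<inter> S" using S(3) by auto
    then show "{r \<in> S. f n r = x} \<in> sets lebesgue"
      using simple_function_levelset_measurable[OF S(2) f[of n], of x] S(1) by simp
  qed
  then show ?thesis
    using AE_lebesgue_on_subset[OF S fl] by (rule strongly_measurable_onI[of S f])
qed

lemma strongly_measurable_on_If:
  assumes S: "S \<in> sets lebesgue" "S' \<in> sets lebesgue"
    and u: "strongly_measurable_on S u" and v: "strongly_measurable_on S' v"
  shows "strongly_measurable_on (S \<union> S') (\<lambda>r. if r \<in> S then u r else v r)"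
proof (rule strongly_measurable_onE[OF u], rule strongly_measurable_onE[OF v])
  fix f g assume f: "\<And>n::nat. simple_function (lebesgue_on S) (f n)"
    and fl: "AE r in lebesgue_on S. (\<lambda>n. f n r) \<longlonglongrightarrow> u r"
    and g: "\<And>n::nat. simple_function (lebesgue_on S') (g n)"
    and gl: "AE r in lebesgue_on S'. (\<lambda>n. g n r) \<longlonglongrightarrow> v r"
  have SS: "S \<union> S' \<in> sets lebesgue" using S by auto
  define h where "h n r = (if r \<in> S then f n r else g n r)" for n r
  have "simple_function (lebesgue_on (S \<union> S')) (h n)" for n
    unfolding simple_function_lebesgue_on_iff[OF SS]
  proof (intro conjI ballI)
    have "h n ` (S \<union> S') \<subseteq> f n ` S \<union> g n ` S'" by (auto simp: h_def)
    moreover have "finite (f n ` S)" "finite (g n ` S')"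
      using f[of n] g[of n] S by (simp_all add: simple_function_lebesgue_on_iff)
    ultimately show "finite (h n ` (S \<union> S'))" by (meson finite_Un finite_subset)
    fix x
    have "{r \<in> S \<union> S'. h n r = x} = {r \<in> S. f n r = x} \<union> ({r \<in> S'. g n r = x} - S)"
      by (auto simp: h_def)
    then show "{r \<in> S \<union> S'. h n r = x} \<in> sets lebesgue"
      using simple_function_levelset_measurable[OF S(1) f[of n], of x]
        simple_function_levelset_measurable[OF S(2) g[of n], of x] S by simp
  qed
  moreover have "AE r in lebesgue_on (S \<union> S'). (\<lambda>n. h n r) \<longlonglongrightarrow> (if r \<in> S then u r else v r)"
  proof (rule AE_lebesgue_onE[OF S(1) fl], rule AE_lebesgue_onE[OF S(2) gl])
    fix N N' assume N: "negligible N" "\<forall>r\<in>S - N. (\<lambda>n. f n r) \<longlonglongrightarrow> u r"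
      "negligible N'" "\<forall>r\<in>S' - N'. (\<lambda>n. g n r) \<longlonglongrightarrow> v r"
    show ?thesis
    proof (rule AE_lebesgue_onI[OF SS])
      show "negligible (N \<union> N')" using N by simp
      fix r assume "r \<in> S \<union> S'" "r \<notin> N \<union> N'"
      then show "(\<lambda>n. h n r) \<longlonglongrightarrow> (if r \<in> S then u r else v r)"
        using N(2,4) by (cases "r \<in> S") (simp_all add: h_def)
    qed
  qed
  ultimately show ?thesis
    by (rule strongly_measurable_onI[of "S \<union> S'" h])
qed

lemma strongly_measurable_on_shift:
  fixes a b c :: real
  assumes "strongly_measurable_on {a..b} u"
  shows "strongly_measurable_on {a+c..b+c} (\<lambda>r. u (r - c))"
proof (rule strongly_measurable_onE[OF assms])
  fix f assume f: "\<And>n::nat. simple_function (lebesgue_on {a..b}) (f n)"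
    and fl: "AE r in lebesgue_on {a..b}. (\<lambda>n. f n r) \<longlonglongrightarrow> u r"
  have "simple_function (lebesgue_on {a+c..b+c}) (\<lambda>r. f n (r - c))" for n
  proof -
    have S: "{a..b} \<in> sets lebesgue" "{a+c..b+c} \<in> sets lebesgue" by simp_all
    have "(\<lambda>r. f n (r - c)) ` {a+c..b+c} \<subseteq> f n ` {a..b}"
      by (auto intro!: imageI)
    then have "finite ((\<lambda>r. f n (r - c)) ` {a+c..b+c})"
      using f[of n] S(1) finite_subset by (auto simp: simple_function_lebesgue_on_iff)
    moreover have "{r \<in> {a+c..b+c}. f n (r - c) = x} \<in> sets lebesgue" for x
    proof -
      have "{r \<in> {a+c..b+c}. f n (r - c) = x} = (+) c ` {r \<in> {a..b}. f n r = x}" (is "?L = ?R")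
      proof
        show "?L \<subseteq> ?R"
        proof
          fix r assume "r \<in> ?L"
          then have "r = c + (r - c)" "r - c \<in> {r \<in> {a..b}. f n r = x}" by auto
          then show "r \<in> ?R" by (rule image_eqI)
        qed
      qed auto
      then show ?thesis
        using lebesgue_sets_translation[OF simple_function_levelset_measurable[OF S(1) f[of n], of x]] by simp
    qed
    ultimately show ?thesis
      unfolding simple_function_lebesgue_on_iff[OF S(2)] by simp
  qed
  then show ?thesis
    using AE_lebesgue_on_shift[OF fl] by (rule strongly_measurable_onI[of "{a+c..b+c}" "\<lambda>n r. f n (r - c)"])
qed

text \<open>
  On a set of finite measure constants are square integrable, so the affine bound suffices. This is
  how translated, damped and essentially bounded controls are recognised as square integrable.
\<close>

lemma L2_on_dominated:
  assumes S: "S \<in> lmeasurable" and u: "strongly_measurable_on S u" and b: "L2_on S b"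
    and le: "AE r in lebesgue_on S. norm (u r) \<le> K * (1 + norm (b r))"
  shows "L2_on S u"
proof -
  have Sl: "S \<in> sets lebesgue" using S by auto
  interpret finite_measure "lebesgue_on S" using S by (rule finite_measure_lebesgue_on)
  have "integrable (lebesgue_on S) (\<lambda>r. 2 * K\<^sup>2 * (1 + (norm (b r))\<^sup>2))"
    using b unfolding L2_on_def by (intro integrable_mult_right Bochner_Integration.integrable_add integrable_const) simp
  then have "integrable (lebesgue_on S) (\<lambda>r. (norm (u r))\<^sup>2)"
  proof (rule Bochner_Integration.integrable_bound)
    show "(\<lambda>r. (norm (u r))\<^sup>2) \<in> borel_measurable (lebesgue_on S)"
      using strongly_measurable_imp_norm_measurable[OF u Sl] by (rule borel_measurable_power)
    show "AE r in lebesgue_on S. norm ((norm (u r))\<^sup>2) \<le> norm (2 * K\<^sup>2 * (1 + (norm (b r))\<^sup>2))"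
      using le
    proof eventually_elim
      case (elim r)
      have "(norm (u r))\<^sup>2 \<le> (K * (1 + norm (b r)))\<^sup>2"
        using elim by (intro power_mono) auto
      also have "\<dots> = K\<^sup>2 * (1 + norm (b r))\<^sup>2" by (simp add: power_mult_distrib)
      also have "\<dots> \<le> K\<^sup>2 * (2 * (1 + (norm (b r))\<^sup>2))"
      proof (rule mult_left_mono)
        have "0 \<le> (1 - norm (b r))\<^sup>2" by simp
        then show "(1 + norm (b r))\<^sup>2 \<le> 2 * (1 + (norm (b r))\<^sup>2)"
          by (simp add: power2_eq_square algebra_simps)
      qed simp
      also have "\<dots> = norm (2 * K\<^sup>2 * (1 + (norm (b r))\<^sup>2))"
        by (simp add: abs_mult)
      finally show ?case by simp
    qed
  qed
  then show ?thesis using u unfolding L2_on_def by simp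
qed

lemma L2_on_bounded:
  assumes "S \<in> lmeasurable" "strongly_measurable_on S u" "AE r in lebesgue_on S. norm (u r) \<le> K"
  shows "L2_on S u"
proof (rule L2_on_dominated[of S u "\<lambda>_. 0::real"])
  show "L2_on S (\<lambda>_. 0::real)" by (simp add: L2_on_def strongly_measurable_const)
qed (use assms in simp_all)

lemma L2_on_const: "S \<in> lmeasurable \<Longrightarrow> L2_on S (\<lambda>_. c)"
  by (rule L2_on_bounded[where K = "norm c"]) (simp_all add: strongly_measurable_const)

lemma L2_on_imp_integrable_norm:
  assumes S: "S \<in> lmeasurable" and b: "L2_on S b"
  shows "integrable (lebesgue_on S) (\<lambda>r. norm (b r))"
proof -
  have Sl: "S \<in> sets lebesgue" using S by auto
  interpret finite_measure "lebesgue_on S" using S by (rule finite_measure_lebesgue_on)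
  have "integrable (lebesgue_on S) (\<lambda>r. 1 + (norm (b r))\<^sup>2)"
    using b unfolding L2_on_def by (intro Bochner_Integration.integrable_add integrable_const) simp
  then show ?thesis
  proof (rule Bochner_Integration.integrable_bound)
    show "(\<lambda>r. norm (b r)) \<in> borel_measurable (lebesgue_on S)"
      using strongly_measurable_imp_norm_measurable Sl b L2_on_def by blast
    show "AE r in lebesgue_on S. norm (norm (b r)) \<le> norm (1 + (norm (b r))\<^sup>2)"
    proof (rule AE_I2)
      fix r
      have "0 \<le> (1 - norm (b r))\<^sup>2" by simp
      then have "2 * norm (b r) \<le> 1 + (norm (b r))\<^sup>2" by (simp add: power2_diff)
      then have "norm (b r) \<le> 1 + (norm (b r))\<^sup>2" using norm_ge_zero[of "b r"] by linarith
      then show "norm (norm (b r)) \<le> norm (1 + (norm (b r))\<^sup>2)" by simp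
    qed
  qed
qed

lemma L2_on_subset:
  assumes "S \<in> sets lebesgue" "S' \<in> sets lebesgue" "S \<subseteq> S'" "L2_on S' u"
  shows "L2_on S u"
proof -
  have "integrable (lebesgue_on S) (\<lambda>r. (norm (u r))\<^sup>2)"
    using assms set_integrable_subset[of lebesgue S' "\<lambda>r. (norm (u r))\<^sup>2" S]
    by (simp add: L2_on_def integrable_restrict_space set_integrable_def)
  then show ?thesis
    using assms strongly_measurable_on_subset unfolding L2_on_def by metis
qed

lemma L2_on_shift:
  fixes a b c :: real
  assumes "L2_on {a..b} u"
  shows "L2_on {a+c..b+c} (\<lambda>r. u (r - c))"
proof -
  have "integrable lebesgue (\<lambda>r. if r \<in> {a..b} then (norm (u r))\<^sup>2 else 0)"
    using assms by (simp add: L2_on_def Lebesgue_Measure.integrable_restrict_UNIV del: atLeastAtMost_iff)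
  then have "integrable lebesgue (\<lambda>r. if - c + 1 * r \<in> {a..b} then (norm (u (- c + 1 * r)))\<^sup>2 else 0)"
    by (rule lebesgue_integrable_real_affine) simp
  also have "(\<lambda>r. if - c + 1 * r \<in> {a..b} then (norm (u (- c + 1 * r)))\<^sup>2 else 0)
     = (\<lambda>r. if r \<in> {a+c..b+c} then (norm (u (r - c)))\<^sup>2 else 0)"
    by (auto simp: fun_eq_iff)
  finally have "integrable (lebesgue_on {a+c..b+c}) (\<lambda>r. (norm (u (r - c)))\<^sup>2)"
    by (simp add: Lebesgue_Measure.integrable_restrict_UNIV del: atLeastAtMost_iff)
  then show ?thesis
    using assms strongly_measurable_on_shift unfolding L2_on_def by metis
qed

lemma L2_on_If:
  assumes S: "S \<in> sets lebesgue" "S' \<in> sets lebesgue" and u: "L2_on S u" and v: "L2_on S' v"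
  shows "L2_on (S \<union> S') (\<lambda>r. if r \<in> S then u r else v r)"
proof -
  have SS: "S \<union> S' \<in> sets lebesgue" "S' - S \<in> sets lebesgue" using S by auto
  have "L2_on (S' - S) v" by (rule L2_on_subset[OF SS(2) S(2) _ v]) simp
  then have "integrable lebesgue (\<lambda>r. (if r \<in> S then (norm (u r))\<^sup>2 else 0)
      + (if r \<in> S' - S then (norm (v r))\<^sup>2 else 0))"
    using u S Lebesgue_Measure.integrable_restrict_UNIV[OF S(1), of "\<lambda>r. (norm (u r))\<^sup>2"]
      Lebesgue_Measure.integrable_restrict_UNIV[OF SS(2), of "\<lambda>r. (norm (v r))\<^sup>2"]
    by (intro Bochner_Integration.integrable_add) (simp_all only: L2_on_def)
  also have "(\<lambda>r. (if r \<in> S then (norm (u r))\<^sup>2 else 0) + (if r \<in> S' - S then (norm (v r))\<^sup>2 else 0))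
    = (\<lambda>r. if r \<in> S \<union> S' then (norm (if r \<in> S then u r else v r))\<^sup>2 else 0)"
    by (auto simp: fun_eq_iff)
  finally have "integrable (lebesgue_on (S \<union> S')) (\<lambda>r. (norm (if r \<in> S then u r else v r))\<^sup>2)"
    using SS by (simp add: Lebesgue_Measure.integrable_restrict_UNIV del: Un_iff)
  then show ?thesis
    using strongly_measurable_on_If[OF S, of u v] u v unfolding L2_on_def by simp
qed

lemma L2_on_diff_const:
  assumes "S \<in> lmeasurable" "L2_on S u"
  shows "L2_on S (\<lambda>r. u r - c)"
proof (rule L2_on_dominated[of S _ u "1 + norm c"])
  show "strongly_measurable_on S (\<lambda>r. u r - c)"
    using assms by (intro strongly_measurable_compose[of S u "\<lambda>x. x - c"]) (auto simp: L2_on_def intro: continuous_intros)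
  have "norm (u r - c) \<le> (1 + norm c) * (1 + norm (u r))" for r
  proof -
    have "norm (u r - c) \<le> norm c + norm (u r)" using norm_triangle_ineq4[of "u r" c] by simp
    moreover have "0 \<le> norm c * norm (u r)" by simp
    ultimately show ?thesis by (simp only: distrib_left distrib_right mult_1 mult_1_right)
  qed
  then show "AE r in lebesgue_on S. norm (u r - c) \<le> (1 + norm c) * (1 + norm (u r))" by simp
qed (use assms in auto)

lemma continuous_imp_strongly_measurable_on:
  fixes \<eta> :: "real \<Rightarrow> real"
  assumes "continuous_on S \<eta>" and "S \<in> sets lebesgue"
  shows "strongly_measurable_on S \<eta>"
proof -
  have "\<eta> \<in> borel_measurable (lebesgue_on S)"
    using assms by (rule continuous_imp_measurable_on_sets_lebesgue)
  from borel_measurable_implies_sequence_metric[OF this, of 0]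
  obtain F where F: "\<forall>i. simple_function (lebesgue_on S) (F i)"
    "\<forall>x\<in>space (lebesgue_on S). (\<lambda>i. F i x) \<longlonglongrightarrow> \<eta> x"
    by blast
  show ?thesis
    by (rule strongly_measurable_onI[of S F]) (use F in \<open>auto intro: AE_I2\<close>)
qed

text \<open>
  Strict inequality lets a bound from the defining set of the infimum be used directly, without
  showing that the infimum is attained.
\<close>

lemma Linf_norm_less_imp_AE:
  assumes "Linf_on S u" and "Linf_norm S u < c"
  shows "AE r in lebesgue_on S. norm (u r) \<le> c"
proof -
  define X where "X = {c. 0 \<le> c \<and> (AE r in lebesgue_on S. norm (u r) \<le> c)}"
  obtain c0 where c0: "AE r in lebesgue_on S. norm (u r) \<le> c0"
    using assms(1) unfolding Linf_on_def by (elim conjE exE) (rule that)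
  have "AE r in lebesgue_on S. norm (u r) \<le> max c0 0"
    using c0 by (rule AE_mp) (intro AE_I2 impI max.coboundedI1)
  then have "X \<noteq> {}" unfolding X_def by (intro ex_in_conv[THEN iffD1] exI[of _ "max c0 0"]) simp
  moreover have "Inf X < c" using assms(2) by (simp add: Linf_norm_def X_def)
  ultimately obtain c1 where "c1 \<in> X" "c1 < c" by (rule cInf_lessD[THEN bexE])
  then have c1: "AE r in lebesgue_on S. norm (u r) \<le> c1" "c1 < c" by (simp_all add: X_def)
  show ?thesis
    using c1(1) by (rule AE_mp) (rule AE_I2, use c1(2) in simp)
qed

section \<open>Integrals of vector-valued functions of one real variable\<close>

text \<open>
  Riemann sums of \<open>g - h\<close> are dominated by those of \<open>\<phi>\<close>, which are close to the small integral of \<open>\<phi>\<close>.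
  So the Cauchy criterion passes from \<open>h\<close> to \<open>g\<close>. This serves as the convergence theorem for
  functions with values in a Banach space.
\<close>

lemma integrable_on_L1_limit:
  fixes g :: "real \<Rightarrow> 'a::banach"
  assumes approx: "\<And>e::real. e > 0 \<Longrightarrow> \<exists>h \<phi>. h integrable_on {a..b} \<and> \<phi> integrable_on {a..b} \<and>
      integral {a..b} \<phi> \<le> e \<and> (\<forall>x\<in>{a..b}. norm (g x - h x) \<le> \<phi> x)"
  shows "g integrable_on {a..b}"
proof -
  have "g integrable_on cbox a b"
    unfolding integrable_Cauchy
  proof (intro allI impI)
    fix e :: real assume "e > 0"
    then have "e/8 > 0" "e/4 > 0" by simp_all
    obtain h \<phi> where h: "h integrable_on cbox a b" and \<phi>: "\<phi> integrable_on cbox a b"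
      and I: "integral (cbox a b) \<phi> \<le> e/8" and le: "\<And>x. x \<in> cbox a b \<Longrightarrow> norm (g x - h x) \<le> \<phi> x"
      using approx[OF \<open>e/8 > 0\<close>] by auto
    from h[unfolded integrable_Cauchy, rule_format, OF \<open>e/4 > 0\<close>]
    obtain \<gamma> where \<gamma>: "gauge \<gamma>" and C: "\<And>p q. p tagged_division_of cbox a b \<and> \<gamma> fine p \<and> q tagged_division_of cbox a b \<and> \<gamma> fine q
       \<Longrightarrow> norm ((\<Sum>(x,K)\<in>p. measure lborel K *\<^sub>R h x) - (\<Sum>(x,K)\<in>q. measure lborel K *\<^sub>R h x)) < e/4"
      by auto
    have "(\<phi> has_integral (integral (cbox a b) \<phi>)) (cbox a b)"
      using \<phi> by (rule integrable_integral)
    then obtain \<delta> where \<delta>: "gauge \<delta>" and D: "\<And>p. p tagged_division_of cbox a b \<and> \<delta> fine p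
       \<Longrightarrow> norm ((\<Sum>(x,K)\<in>p. measure lborel K *\<^sub>R \<phi> x) - integral (cbox a b) \<phi>) < e/8"
      unfolding has_integral using \<open>e/8 > 0\<close> by metis
    have close: "norm ((\<Sum>(x,K)\<in>p. measure lborel K *\<^sub>R g x) - (\<Sum>(x,K)\<in>p. measure lborel K *\<^sub>R h x)) < e/4"
      if p: "p tagged_division_of cbox a b" "\<delta> fine p" for p
    proof -
      have "(\<Sum>(x,K)\<in>p. measure lborel K *\<^sub>R g x) - (\<Sum>(x,K)\<in>p. measure lborel K *\<^sub>R h x)
          = (\<Sum>(x,K)\<in>p. measure lborel K *\<^sub>R (g x - h x))"
        by (simp add: sum_subtractf[symmetric] case_prod_beta scaleR_diff_right)
      also have "norm \<dots> \<le> (\<Sum>(x,K)\<in>p. measure lborel K *\<^sub>R \<phi> x)"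
      proof (rule sum_norm_le, clarify)
        fix x K assume "(x, K) \<in> p"
        then have "x \<in> cbox a b" using p(1) by (meson tag_in_interval)
        then show "norm (measure lborel K *\<^sub>R (g x - h x)) \<le> measure lborel K *\<^sub>R \<phi> x"
          using le by (simp add: mult_left_mono)
      qed
      also have "\<dots> < e/4" using D[OF conjI[OF p]] I unfolding real_norm_def abs_less_iff by linarith
      finally show ?thesis .
    qed
    show "\<exists>\<gamma>. gauge \<gamma> \<and>
          (\<forall>p q. p tagged_division_of (cbox a b) \<and> \<gamma> fine p \<and>
            q tagged_division_of (cbox a b) \<and> \<gamma> fine q \<longrightarrow>
            norm ((\<Sum>(x,K)\<in>p. measure lborel K *\<^sub>R g x) - (\<Sum>(x,K)\<in>q. measure lborel K *\<^sub>R g x)) < e)"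
    proof (intro exI[of _ "\<lambda>x. \<gamma> x \<inter> \<delta> x"] conjI allI impI)
      show "gauge (\<lambda>x. \<gamma> x \<inter> \<delta> x)" using \<gamma> \<delta> by (rule gauge_Int)
      fix p q
      assume "p tagged_division_of (cbox a b) \<and> (\<lambda>x. \<gamma> x \<inter> \<delta> x) fine p \<and>
            q tagged_division_of (cbox a b) \<and> (\<lambda>x. \<gamma> x \<inter> \<delta> x) fine q"
      then have p: "p tagged_division_of (cbox a b)" "\<gamma> fine p" "\<delta> fine p"
        and q: "q tagged_division_of (cbox a b)" "\<gamma> fine q" "\<delta> fine q"
        by (simp_all add: fine_Int)
      define Gp Gq Hp Hq where "Gp = (\<Sum>(x,K)\<in>p. measure lborel K *\<^sub>R g x)" and "Gq = (\<Sum>(x,K)\<in>q. measure lborel K *\<^sub>R g x)"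
        and "Hp = (\<Sum>(x,K)\<in>p. measure lborel K *\<^sub>R h x)" and "Hq = (\<Sum>(x,K)\<in>q. measure lborel K *\<^sub>R h x)"
      have "norm (Gp - Hp) < e/4" "norm (Gq - Hq) < e/4" "norm (Hp - Hq) < e/4"
        using close[OF p(1,3)] close[OF q(1,3)] C[of p q] p q unfolding Gp_def Gq_def Hp_def Hq_def by auto
      moreover have "Gp - Gq = (Gp - Hp) + (Hp - Hq) - (Gq - Hq)" by simp
      moreover have "norm ((Gp - Hp) + (Hp - Hq) - (Gq - Hq)) \<le> norm (Gp - Hp) + norm (Hp - Hq) + norm (Gq - Hq)"
        by (meson norm_triangle_ineq norm_triangle_ineq4 add_mono order_refl order_trans)
      ultimately show "norm ((\<Sum>(x,K)\<in>p. measure lborel K *\<^sub>R g x) - (\<Sum>(x,K)\<in>q. measure lborel K *\<^sub>R g x)) < e"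
        unfolding Gp_def[symmetric] Gq_def[symmetric] using \<open>e > 0\<close> by simp
    qed
  qed
  then show ?thesis by simp
qed

text \<open>
  On an interval so short that \<open>k\<close> hardly varies, \<open>k\<close> may be replaced by a constant, and a constant
  multiple of the indicator of a measurable set is integrable.
\<close>

lemma integrable_on_indicator_scaleR_continuous:
  fixes k :: "real \<Rightarrow> 'a::banach"
  assumes E: "E \<in> sets lebesgue" and k: "continuous_on {a..b} k"
  shows "(\<lambda>r. indicat_real E r *\<^sub>R k r) integrable_on {a..b}"
proof -
  have const: "(\<lambda>r. indicat_real E r *\<^sub>R c) integrable_on cbox x y" for c x y
  proof -
    have "E \<inter> cbox x y \<in> lmeasurable"
      using E by (intro fmeasurable_Int_fmeasurable[of "cbox x y" lebesgue E, simplified Int_commute]) auto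
    then have "indicat_real E integrable_on cbox x y"
      by (simp add: integrable_on_indicator Int_commute)
    from integrable_linear[OF this bounded_linear_scaleR_left[of c]] show ?thesis
      by (simp add: o_def)
  qed
  have "(\<lambda>r. indicat_real E r *\<^sub>R k r) integrable_on cbox a b"
  proof (rule integrable_uniform_limit)
    fix e :: real assume e: "e > 0"
    obtain d where "0 < d" and d: "\<And>x x'. \<lbrakk>x \<in> cbox a b; x' \<in> cbox a b; dist x' x < d\<rbrakk> \<Longrightarrow> dist (k x') (k x) < e"
      using compact_uniformly_continuous[of "cbox a b" k] k e unfolding uniformly_continuous_on_def
      by (metis compact_cbox interval_cbox)
    obtain p where ptag: "p tagged_division_of cbox a b" and finep: "(\<lambda>x. ball x d) fine p"
      using fine_division_exists[OF gauge_ball[OF \<open>0 < d\<close>], of a b] .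
    have *: "\<forall>i\<in>snd ` p. \<exists>g. (\<forall>x\<in>i. norm (indicat_real E x *\<^sub>R k x - g x) \<le> e) \<and> g integrable_on i"
    proof clarsimp
      fix x l assume as: "(x, l) \<in> p"
      obtain x1 y1 where l: "l = cbox x1 y1" using as ptag by blast
      have x: "x \<in> cbox a b" using as ptag by (meson tag_in_interval)
      show "\<exists>g. (\<forall>z\<in>l. norm (indicat_real E z *\<^sub>R k z - g z) \<le> e) \<and> g integrable_on l"
      proof (intro exI conjI ballI)
        show "(\<lambda>r. indicat_real E r *\<^sub>R k x) integrable_on l" unfolding l by (rule const)
        fix z assume z: "z \<in> l"
        have "l \<subseteq> cbox a b" using ptag as by (rule tagged_division_ofD(3))
        moreover have "l \<subseteq> ball x d" using finep as by (rule fineD)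
        ultimately have "z \<in> cbox a b" "dist z x < d"
          using z by (auto simp: dist_commute)
        then have "norm (k z - k x) < e" using d x by (simp add: dist_norm)
        moreover have "indicat_real E z *\<^sub>R k z - indicat_real E z *\<^sub>R k x = indicat_real E z *\<^sub>R (k z - k x)"
          by (simp add: scaleR_diff_right)
        ultimately show "norm (indicat_real E z *\<^sub>R k z - indicat_real E z *\<^sub>R k x) \<le> e"
          using e by (simp add: indicator_def)
      qed
    qed
    from e have "0 \<le> e" by simp
    from approximable_on_division[OF this division_of_tagged_division[OF ptag] *]
    show "\<exists>g. (\<forall>x\<in>cbox a b. norm (indicat_real E x *\<^sub>R k x - g x) \<le> e) \<and> g integrable_on cbox a b"
      by metis
  qed
  then show ?thesis by simp
qed

lemma integrable_on_apply_simple_function: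
  fixes W :: "real \<Rightarrow> 'b::real_normed_vector \<Rightarrow> 'a::banach"
  assumes W: "\<And>x. continuous_on {a..b} (\<lambda>r. W r x)"
    and u: "simple_function (lebesgue_on {a..b}) u"
  shows "(\<lambda>r. W r (u r)) integrable_on {a..b}"
proof -
  define S where "S = {a..b}"
  have S: "S \<in> sets lebesgue" and u': "simple_function (lebesgue_on S) u" 
    using u by (simp_all add: S_def)
  have fin: "finite (u ` S)" using u' by (simp add: simple_function_lebesgue_on_iff[OF S])
  have "(\<lambda>r. \<Sum>c\<in>u ` S. indicat_real {r \<in> S. u r = c} r *\<^sub>R W r c) integrable_on S"
    using simple_function_levelset_measurable[OF S u'] W
    by (intro integrable_sum fin) (simp add: S_def integrable_on_indicator_scaleR_continuous del: atLeastAtMost_iff)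
  then have "(\<lambda>r. W r (u r)) integrable_on S"
  proof (rule integrable_eq)
    fix r assume r: "r \<in> S"
    have "(\<Sum>c\<in>u ` S. indicat_real {r \<in> S. u r = c} r *\<^sub>R W r c) = (\<Sum>c\<in>u ` S. if u r = c then W r c else 0)"
      using r by (intro sum.cong) (auto simp: indicator_def)
    also have "\<dots> = W r (u r)" using fin r by (simp add: sum.delta')
    finally show "(\<Sum>c\<in>u ` S. indicat_real {r \<in> S. u r = c} r *\<^sub>R W r c) = W r (u r)" .
  qed
  then show ?thesis by (simp add: S_def)
qed

text \<open>
  Truncating the simple functions \<open>f n\<close> where they are far from \<open>u\<close> gives simple functions \<open>g n\<close> with
  \<open>norm (g n r - u r) \<le> 1 + norm (u r)\<close>. Scalar dominated convergence then shows that \<open>g n\<close> tends to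
  \<open>u\<close> in \<open>L\<^sup>1\<close>, so \<open>W r (u r)\<close> is an \<open>L\<^sup>1\<close> limit in the sense of \<open>integrable_on_L1_limit\<close>.
\<close>

lemma integrable_on_apply_strongly_measurable:
  fixes W :: "real \<Rightarrow> 'b::real_normed_vector \<Rightarrow> 'a::banach"
  assumes W: "\<And>x. continuous_on {a..b} (\<lambda>r. W r x)"
    and lin: "\<And>r x y. W r (x - y) = W r x - W r y" and bd: "\<And>r x. norm (W r x) \<le> M * norm x"
    and u: "strongly_measurable_on {a..b} u"
    and int: "integrable (lebesgue_on {a..b}) (\<lambda>r. norm (u r))"
  shows "(\<lambda>r. W r (u r)) integrable_on {a..b}"
proof (rule integrable_on_L1_limit)
  fix e :: real assume e: "e > 0"
  define S where "S = {a..b}"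
  have S: "S \<in> sets lebesgue" "S \<in> lmeasurable" by (simp_all add: S_def)
  interpret finite_measure "lebesgue_on S" using S(2) by (rule finite_measure_lebesgue_on)
  have u: "strongly_measurable_on S u" and int: "integrable (lebesgue_on S) (\<lambda>r. norm (u r))"
    using u int by (simp_all add: S_def)
  obtain f where f: "\<And>n::nat. simple_function (lebesgue_on S) (f n)"
    and fl: "AE r in lebesgue_on S. (\<lambda>n. f n r) \<longlonglongrightarrow> u r"
    by (rule strongly_measurable_onE[OF u]) (rule that)
  define M' where "M' = \<bar>M\<bar>"
  have bd': "norm (W r x) \<le> M' * norm x" for r x
    using bd[of r x] by (rule order_trans) (simp add: M'_def mult_right_mono)
  \<comment> \<open>Where \<open>f n r\<close> is far from \<open>u r\<close> it is replaced by \<open>0\<close>, so that the error never exceeds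
    \<open>1 + norm (u r)\<close>; almost every \<open>r\<close> belongs to \<open>E n\<close> for all large \<open>n\<close>.\<close>
  define E where "E n = {r \<in> S. norm (f n r - u r) \<le> 1 + norm (u r)}" for n
  define g where "g n r = (if indicat_real (E n) r = 1 then f n r else 0)" for n r
  have fsm: "strongly_measurable_on S (f n)" for n
    by (rule strongly_measurable_onI[of S "\<lambda>_. f n"]) (simp_all add: f)
  have Em: "E n \<in> sets (lebesgue_on S)" for n
  proof -
    have "(\<lambda>r. norm (f n r - u r)) \<in> borel_measurable (lebesgue_on S)"
      by (intro strongly_measurable_imp_norm_measurable S strongly_measurable_compose2[OF fsm u])
         (intro continuous_intros)
    moreover have "(\<lambda>r. 1 + norm (u r)) \<in> borel_measurable (lebesgue_on S)"
      using strongly_measurable_imp_norm_measurable[OF u S(1)] by (intro borel_measurable_add) simp_all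
    ultimately have "{r \<in> space (lebesgue_on S). norm (f n r - u r) \<le> 1 + norm (u r)} \<in> sets (lebesgue_on S)"
      by (rule borel_measurable_le)
    then show ?thesis by (simp add: E_def)
  qed
  have g: "simple_function (lebesgue_on S) (g n)" for n
    using simple_function_compose2[OF f[of n] simple_function_indicator[OF Em[of n]], of "\<lambda>x i. if i = (1::real) then x else 0"]
    unfolding g_def .
  have gsm: "strongly_measurable_on S (g n)" for n
    by (rule strongly_measurable_onI[of S "\<lambda>_. g n"]) (simp_all add: g)
  define \<phi> where "\<phi> n r = M' * norm (g n r - u r)" for n r
  have dom: "integrable (lebesgue_on S) (\<lambda>r. M' * (1 + norm (u r)))"
    using int by (intro integrable_mult_right Bochner_Integration.integrable_add integrable_const)
  have \<phi>m: "\<phi> n \<in> borel_measurable (lebesgue_on S)" for n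
    unfolding \<phi>_def
    by (intro borel_measurable_times borel_measurable_const strongly_measurable_imp_norm_measurable S strongly_measurable_compose2[OF gsm u])
       (intro continuous_intros)
  have \<phi>b: "norm (\<phi> n r) \<le> M' * (1 + norm (u r))" if "r \<in> S" for n r
  proof -
    have "norm (g n r - u r) \<le> 1 + norm (u r)"
      using that by (auto simp: g_def E_def indicator_def)
    then show ?thesis by (simp add: \<phi>_def abs_mult M'_def mult_left_mono)
  qed
  have \<phi>l: "AE r in lebesgue_on S. (\<lambda>n. \<phi> n r) \<longlonglongrightarrow> 0"
    using fl AE_space
  proof eventually_elim
    case (elim r)
    then have r: "r \<in> S" by simp
    have *: "(\<lambda>n. norm (f n r - u r)) \<longlonglongrightarrow> 0"
      using elim(1) by (simp add: tendsto_norm_zero_iff LIM_zero_iff)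
    then have "\<forall>\<^sub>F n in sequentially. norm (f n r - u r) < 1"
      by (rule order_tendstoD) simp
    then have "\<forall>\<^sub>F n in sequentially. M' * norm (f n r - u r) = \<phi> n r"
    proof eventually_elim
      case (elim n)
      then have "norm (f n r - u r) \<le> 1 + norm (u r)" using norm_ge_zero[of "u r"] by linarith
      then show ?case using r by (simp add: \<phi>_def g_def E_def)
    qed
    moreover have "(\<lambda>n. M' * norm (f n r - u r)) \<longlonglongrightarrow> 0"
      using tendsto_mult_right_zero[OF *] .
    ultimately show ?case by (rule Lim_transform_eventually[rotated])
  qed
  have "(\<lambda>n. integral\<^sup>L (lebesgue_on S) (\<phi> n)) \<longlonglongrightarrow> integral\<^sup>L (lebesgue_on S) (\<lambda>_. 0)"
    using dom \<phi>m \<phi>l \<phi>b by (intro integral_dominated_convergence[where w = "\<lambda>r. M' * (1 + norm (u r))"]) auto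
  then have "(\<lambda>n. integral\<^sup>L (lebesgue_on S) (\<phi> n)) \<longlonglongrightarrow> 0" by simp
  then have "\<forall>\<^sub>F n in sequentially. integral\<^sup>L (lebesgue_on S) (\<phi> n) < e"
    by (rule order_tendstoD) (rule e)
  then obtain n where n: "integral\<^sup>L (lebesgue_on S) (\<phi> n) < e"
    by (auto simp: eventually_sequentially)
  have \<phi>i: "integrable (lebesgue_on S) (\<phi> n)"
    using dom \<phi>m
  proof (rule Bochner_Integration.integrable_bound)
    show "AE r in lebesgue_on S. norm (\<phi> n r) \<le> norm (M' * (1 + norm (u r)))"
      by (rule AE_I2) (use \<phi>b in \<open>force intro: order_trans[OF _ abs_ge_self]\<close>)
  qed
  have "integral S (\<phi> n) \<le> e" "\<phi> n integrable_on S"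
    using n integrable_on_lebesgue_on[OF \<phi>i S(1)] lebesgue_integral_eq_integral[OF \<phi>i S(1)] by simp_all
  moreover have "(\<lambda>r. W r (g n r)) integrable_on S"
    using integrable_on_apply_simple_function[of a b W "g n"] W g unfolding S_def by blast
  moreover have "norm (W r (u r) - W r (g n r)) \<le> \<phi> n r" for r
    using bd'[of r "u r - g n r"] by (simp add: lin \<phi>_def norm_minus_commute)
  ultimately show "\<exists>h \<phi>. h integrable_on {a..b} \<and> \<phi> integrable_on {a..b} \<and>
      integral {a..b} \<phi> \<le> e \<and> (\<forall>x\<in>{a..b}. norm (W x (u x) - h x) \<le> \<phi> x)"
    unfolding S_def by blast
qed

text \<open>
  The primitive of an integrable function need not be differentiable everywhere, so the product rule
  cannot be applied to \<open>\<eta> p\<close>. Instead the difference \<open>\<Phi>\<close> of the two sides, as a function of the upper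
  limit, is shown to be constant: on \<open>[s, t]\<close> it changes by at most a multiple of
  \<open>(t - s) \<integral>\<^sub>s\<^sup>t m\<close>, which is \<open>o(t - s)\<close>, so its derivative vanishes everywhere.
\<close>

lemma integral_by_parts_L1:
  fixes q :: "real \<Rightarrow> 'a::banach" and \<eta> \<psi> m :: "real \<Rightarrow> real"
  assumes ab: "a \<le> b" and q: "q integrable_on {a..b}" and m: "m integrable_on {a..b}"
    and qm: "\<And>r. r \<in> {a..b} \<Longrightarrow> norm (q r) \<le> m r"
    and \<eta>: "\<And>r. r \<in> {a..b} \<Longrightarrow> (\<eta> has_real_derivative \<psi> r) (at r within {a..b})"
    and \<psi>: "continuous_on {a..b} \<psi>"
    and \<eta>q: "(\<lambda>r. \<eta> r *\<^sub>R q r) integrable_on {a..b}"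
  shows "integral {a..b} (\<lambda>r. \<eta> r *\<^sub>R q r)
    = \<eta> b *\<^sub>R integral {a..b} q - integral {a..b} (\<lambda>r. \<psi> r *\<^sub>R integral {a..r} q)"
proof -
  define p where "p t = integral {a..t} q" for t
  define M where "M t = integral {a..t} m" for t
  \<comment> \<open>With the derivative of \<open>p\<close> replaced by \<open>q\<close>, the formal derivative of \<open>\<Phi>\<close> is zero.\<close>
  define \<Phi> where "\<Phi> t = integral {a..t} (\<lambda>r. \<eta> r *\<^sub>R q r) - \<eta> t *\<^sub>R p t + integral {a..t} (\<lambda>r. \<psi> r *\<^sub>R p r)" for t
  have pc: "continuous_on {a..b} p"
    unfolding p_def using indefinite_integral_continuous_1[OF q] .
  have Mc: "continuous_on {a..b} M"
    unfolding M_def using indefinite_integral_continuous_1[OF m] .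
  have \<psi>p: "(\<lambda>r. \<psi> r *\<^sub>R p r) integrable_on {a..b}"
    by (intro integrable_continuous_real continuous_on_scaleR pc \<psi>)
  obtain L where L: "\<And>r. r \<in> {a..b} \<Longrightarrow> \<bar>\<psi> r\<bar> \<le> L"
  proof -
    have "compact (\<psi> ` {a..b})"
      using \<psi> by (intro compact_continuous_image) simp_all
    then have "bounded (\<psi> ` {a..b})" by (rule compact_imp_bounded)
    then obtain L where "\<forall>x\<in>\<psi> ` {a..b}. norm x \<le> L" unfolding bounded_iff ..
    then show thesis by (intro that[of L]) simp
  qed
  have L0: "0 \<le> L" using L[of a] ab by simp
  have split: "integral {a..t} f - integral {a..s} f = integral {s..t} f"
    if "f integrable_on {a..b}" "a \<le> s" "s \<le> t" "t \<le> b" for f :: "real \<Rightarrow> 'c::banach" and s t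
  proof -
    have "f integrable_on {a..t}" using that by (intro integrable_subinterval_real[OF that(1)]) auto
    from Henstock_Kurzweil_Integration.integral_combine[OF that(2,3) this] show ?thesis by (simp add: algebra_simps)
  qed
  have sub: "f integrable_on {s..t}" if "f integrable_on {a..b}" "a \<le> s" "t \<le> b"
    for f :: "real \<Rightarrow> 'c::banach" and s t
    using that by (intro integrable_subinterval_real[OF that(1)]) auto
  have key: "norm (\<Phi> t - \<Phi> s) \<le> 2 * L * (M t - M s) * (t - s)" if st: "a \<le> s" "s \<le> t" "t \<le> b" for s t
  proof -
    have \<psi>int: "(\<psi> has_integral (\<eta> r - \<eta> s)) {s..r}" if r: "r \<in> {s..t}" for r
    proof (rule fundamental_theorem_of_calculus)
      fix x assume "x \<in> {s..r}"
      then have "(\<eta> has_real_derivative \<psi> x) (at x within {s..r})"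
        using r st by (intro DERIV_subset[OF \<eta>]) auto
      then show "(\<eta> has_vector_derivative \<psi> x) (at x within {s..r})"
        by (simp add: has_real_derivative_iff_has_vector_derivative)
    qed (use r in simp)
    have \<eta>d: "\<bar>\<eta> r - \<eta> s\<bar> \<le> L * (t - s)" if r: "r \<in> {s..t}" for r
    proof -
      have "norm (\<eta> r - \<eta> s) \<le> L * measure lborel (cbox s r)"
        using \<psi>int[OF r] L r st by (intro has_integral_bound[OF L0]) auto
      also have "\<dots> \<le> L * (t - s)" using r L0 by (intro mult_left_mono) auto
      finally show ?thesis by simp
    qed
    have pd: "norm (p r - p t) \<le> M t - M s" if r: "r \<in> {s..t}" for r
    proof -
      have "p t - p r = integral {r..t} q" using split[OF q, of r t] r st by (simp add: p_def)
      then have "norm (p r - p t) = norm (integral {r..t} q)" by (metis norm_minus_commute)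
      also have "\<dots> \<le> integral {r..t} m"
      proof (rule integral_norm_bound_integral)
        show "q integrable_on {r..t}" "m integrable_on {r..t}"
          using r st by (simp_all add: sub[OF q] sub[OF m])
        show "norm (q x) \<le> m x" if "x \<in> {r..t}" for x
          using that r st qm[of x] by simp
      qed
      also have "\<dots> = M t - M r" using split[OF m, of r t] r st by (simp add: M_def)
      also have "\<dots> \<le> M t - M s"
      proof -
        have "0 \<le> integral {s..r} m"
        proof (rule integral_nonneg)
          show "m integrable_on {s..r}" using r st by (simp add: sub[OF m])
          show "0 \<le> m x" if "x \<in> {s..r}" for x
            using that r st qm[of x] order_trans[OF norm_ge_zero] by simp
        qed
        then show ?thesis using split[OF m, of s r] r st by (simp add: M_def)
      qed
      finally show ?thesis .
    qed
    have i1: "((\<lambda>r. \<eta> r *\<^sub>R q r - \<eta> s *\<^sub>R q r) has_integral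
       (integral {s..t} (\<lambda>r. \<eta> r *\<^sub>R q r) - \<eta> s *\<^sub>R integral {s..t} q)) {s..t}"
      by (intro has_integral_diff has_integral_cmul integrable_integral sub[OF q] sub[OF \<eta>q] st)
    have i2: "((\<lambda>r. \<psi> r *\<^sub>R p r - \<psi> r *\<^sub>R p t) has_integral
       (integral {s..t} (\<lambda>r. \<psi> r *\<^sub>R p r) - (\<eta> t - \<eta> s) *\<^sub>R p t)) {s..t}"
    proof (rule has_integral_diff)
      show "((\<lambda>r. \<psi> r *\<^sub>R p r) has_integral integral {s..t} (\<lambda>r. \<psi> r *\<^sub>R p r)) {s..t}"
        by (intro integrable_integral sub[OF \<psi>p] st)
      show "((\<lambda>r. \<psi> r *\<^sub>R p t) has_integral (\<eta> t - \<eta> s) *\<^sub>R p t) {s..t}"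
        using has_integral_linear[OF \<psi>int[of t] bounded_linear_scaleR_left[of "p t"]] st by (simp add: o_def)
    qed
    \<comment> \<open>The increment of \<open>\<Phi>\<close> is the sum of the two quantities bounded next. In the first, \<open>\<eta>\<close> varies by at
      most \<open>L (t - s)\<close> and \<open>q\<close> is dominated by \<open>m\<close>; in the second, \<open>\<psi>\<close> is bounded by \<open>L\<close> and \<open>p\<close> varies by
      at most the integral of \<open>m\<close>.\<close>
    have n1: "norm (integral {s..t} (\<lambda>r. \<eta> r *\<^sub>R q r) - \<eta> s *\<^sub>R integral {s..t} q) \<le> L * (t - s) * (M t - M s)"
    proof -
      have "norm (integral {s..t} (\<lambda>r. \<eta> r *\<^sub>R q r - \<eta> s *\<^sub>R q r)) \<le> integral {s..t} (\<lambda>r. (L * (t - s)) *\<^sub>R m r)"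
      proof (rule integral_norm_bound_integral)
        show "(\<lambda>r. \<eta> r *\<^sub>R q r - \<eta> s *\<^sub>R q r) integrable_on {s..t}" using i1 by blast
        show "(\<lambda>r. (L * (t - s)) *\<^sub>R m r) integrable_on {s..t}"
          by (intro integrable_cmul sub[OF m] st)
        fix r assume r: "r \<in> {s..t}"
        have "norm (\<eta> r *\<^sub>R q r - \<eta> s *\<^sub>R q r) = \<bar>\<eta> r - \<eta> s\<bar> * norm (q r)"
          by (simp add: scaleR_diff_left[symmetric])
        also have "\<dots> \<le> (L * (t - s)) * m r"
          using \<eta>d[OF r] qm[of r] r st L0 by (intro mult_mono) auto
        finally show "norm (\<eta> r *\<^sub>R q r - \<eta> s *\<^sub>R q r) \<le> (L * (t - s)) *\<^sub>R m r" by simp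
      qed
      then show ?thesis using split[OF m st] by (simp add: integral_unique[OF i1] M_def)
    qed
    have n2: "norm (integral {s..t} (\<lambda>r. \<psi> r *\<^sub>R p r) - (\<eta> t - \<eta> s) *\<^sub>R p t) \<le> L * (M t - M s) * (t - s)"
    proof -
      have "norm (integral {s..t} (\<lambda>r. \<psi> r *\<^sub>R p r - \<psi> r *\<^sub>R p t)) \<le> integral {s..t} (\<lambda>r. L * (M t - M s))"
      proof (rule integral_norm_bound_integral)
        show "(\<lambda>r. \<psi> r *\<^sub>R p r - \<psi> r *\<^sub>R p t) integrable_on {s..t}" using i2 by blast
        fix r assume r: "r \<in> {s..t}"
        have "norm (\<psi> r *\<^sub>R p r - \<psi> r *\<^sub>R p t) = \<bar>\<psi> r\<bar> * norm (p r - p t)"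
          by (simp add: scaleR_diff_right[symmetric])
        also have "\<dots> \<le> L * (M t - M s)"
          using L[of r] pd[OF r] r st L0 by (intro mult_mono) auto
        finally show "norm (\<psi> r *\<^sub>R p r - \<psi> r *\<^sub>R p t) \<le> L * (M t - M s)" .
      qed (rule integrable_const_ivl)
      then show ?thesis using st by (simp add: integral_unique[OF i2] mult_ac)
    qed
    have pq: "integral {s..t} q = p t - p s" using split[OF q st] by (simp add: p_def)
    have "\<Phi> t - \<Phi> s = (integral {s..t} (\<lambda>r. \<eta> r *\<^sub>R q r) - \<eta> s *\<^sub>R integral {s..t} q)
        + (integral {s..t} (\<lambda>r. \<psi> r *\<^sub>R p r) - (\<eta> t - \<eta> s) *\<^sub>R p t)"
      unfolding \<Phi>_def split[OF \<eta>q st, symmetric] split[OF \<psi>p st, symmetric] pq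
      by (simp add: algebra_simps)
    then have "norm (\<Phi> t - \<Phi> s) \<le> L * (t - s) * (M t - M s) + L * (M t - M s) * (t - s)"
      using norm_triangle_mono[OF n1 n2] by (simp only:)
    then show ?thesis by (simp add: mult_ac)
  qed
  have "\<exists>c. \<forall>x\<in>{a..b}. \<Phi> x = c"
  proof (rule has_derivative_zero_constant)
    fix x assume x: "x \<in> {a..b}"
    show "(\<Phi> has_derivative (\<lambda>h. 0)) (at x within {a..b})"
    proof (rule has_derivativeI_sandwich[of 1])
      fix y assume y: "y \<in> {a..b}" "y \<noteq> x" "dist y x < 1"
      have "norm (\<Phi> y - \<Phi> x) \<le> 2 * L * \<bar>M y - M x\<bar> * \<bar>y - x\<bar>"
      proof (cases "x \<le> y")
        case True
        have "2 * L * (M y - M x) * (y - x) \<le> 2 * L * \<bar>M y - M x\<bar> * (y - x)"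
          using True L0 by (intro mult_right_mono mult_left_mono) auto
        then show ?thesis using key[of x y] x y True by auto
      next
        case False
        have "2 * L * (M x - M y) * (x - y) \<le> 2 * L * \<bar>M y - M x\<bar> * (x - y)"
          using False L0 by (intro mult_right_mono mult_left_mono) auto
        then show ?thesis using key[of y x] x y False by (auto simp: norm_minus_commute)
      qed
      then show "norm (\<Phi> y - \<Phi> x - 0) / norm (y - x) \<le> 2 * L * \<bar>M y - M x\<bar>"
        using y by (simp add: divide_le_eq)
    next
      have "(M \<longlongrightarrow> M x) (at x within {a..b})" using Mc x by (simp add: continuous_on)
      then have "((\<lambda>y. 2 * L * \<bar>M y - M x\<bar>) \<longlongrightarrow> 2 * L * \<bar>M x - M x\<bar>) (at x within {a..b})"
        by (intro tendsto_intros)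
      then show "((\<lambda>y. 2 * L * \<bar>M y - M x\<bar>) \<longlongrightarrow> 0) (at x within {a..b})" by simp
    qed simp_all
  qed simp
  then obtain c where "\<forall>x\<in>{a..b}. \<Phi> x = c" ..
  then have "\<Phi> b = \<Phi> a" using ab by simp
  also have "\<Phi> a = 0" by (simp add: \<Phi>_def p_def)
  finally show ?thesis by (simp add: \<Phi>_def p_def algebra_simps)
qed

section \<open>Functions of class \<open>C\<^sup>k\<close> and a cutoff profile\<close>

lemma Ck_on_reals_Suc_imp: "Ck_on_reals (Suc n) f \<Longrightarrow> Ck_on_reals n f"
proof (induction n arbitrary: f)
  case 0
  then obtain f' where "\<And>t. (f has_vector_derivative f' t) (at t)" by auto
  then have "isCont f t" for t by (rule has_vector_derivative_continuous)
  then show ?case by (simp add: continuous_at_imp_continuous_on)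
next
  case (Suc n)
  from Suc.prems obtain f' where "\<And>t. (f has_vector_derivative f' t) (at t)" "Ck_on_reals (Suc n) f'"
    by auto
  then show ?case using Suc.IH[of f'] by (auto simp del: Ck_on_reals.simps(1))
qed

lemma Ck_on_reals_imp_continuous: "Ck_on_reals n f \<Longrightarrow> continuous_on UNIV f"
  by (induction n) (auto dest: Ck_on_reals_Suc_imp simp del: Ck_on_reals.simps(2))

lemma Ck_on_reals_add: "Ck_on_reals n f \<Longrightarrow> Ck_on_reals n g \<Longrightarrow> Ck_on_reals n (\<lambda>t. f t + g t)"
proof (induction n arbitrary: f g)
  case 0
  then show ?case by (simp add: continuous_on_add)
next
  case (Suc n)
  from Suc.prems obtain f' g' where "\<And>t. (f has_vector_derivative f' t) (at t)" "Ck_on_reals n f'"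
     "\<And>t. (g has_vector_derivative g' t) (at t)" "Ck_on_reals n g'"
    by auto
  then show ?case using Suc.IH[of f' g']
    by (auto intro!: exI[of _ "\<lambda>t. f' t + g' t"] has_vector_derivative_add)
qed

lemma Ck_on_reals_const: "Ck_on_reals n (\<lambda>t. c)"
  by (induction n arbitrary: c) (auto intro!: exI[of _ "\<lambda>_. 0"])

lemma Ck_on_reals_scale: "Ck_on_reals n f \<Longrightarrow> Ck_on_reals n (\<lambda>t. c *\<^sub>R f t)"
proof (induction n arbitrary: f)
  case 0
  then show ?case by (simp add: continuous_on_scaleR)
next
  case (Suc n)
  from Suc.prems obtain f' where "\<And>t. (f has_vector_derivative f' t) (at t)" "Ck_on_reals n f'"
    by auto
  then show ?case using Suc.IH[of f']
    by (auto intro!: exI[of _ "\<lambda>t. c *\<^sub>R f' t"] bounded_linear.has_vector_derivative[OF bounded_linear_scaleR_right])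
qed

lemma Ck_on_reals_scale_id: "Ck_on_reals n f \<Longrightarrow> Ck_on_reals n (\<lambda>t. t *\<^sub>R f t)"
proof (induction n arbitrary: f)
  case 0
  then show ?case by (simp add: continuous_on_scaleR)
next
  case (Suc n)
  from Suc.prems obtain f' where f': "\<And>t. (f has_vector_derivative f' t) (at t)" "Ck_on_reals n f'"
    by auto
  have "((\<lambda>t. t *\<^sub>R f t) has_vector_derivative (t *\<^sub>R f' t + 1 *\<^sub>R f t)) (at t)" for t
    by (intro has_vector_derivative_scaleR f'(1) DERIV_ident)
  moreover have "Ck_on_reals n (\<lambda>t. t *\<^sub>R f' t + 1 *\<^sub>R f t)"
    by (intro Ck_on_reals_add Ck_on_reals_scale Suc.IH f'(2) Ck_on_reals_Suc_imp[OF Suc.prems])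
  ultimately show ?case unfolding Ck_on_reals.simps by (intro exI conjI allI)
qed

lemma Ck_on_reals_shift: "Ck_on_reals n f \<Longrightarrow> Ck_on_reals n (\<lambda>t. f (a + t))"
proof (induction n arbitrary: f)
  case 0
  then show ?case by (auto intro!: continuous_on_compose2[of UNIV f] continuous_intros)
next
  case (Suc n)
  from Suc.prems obtain f' where f': "\<And>t. (f has_vector_derivative f' t) (at t)" "Ck_on_reals n f'"
    by auto
  have "((f \<circ> (\<lambda>t. a + t)) has_vector_derivative (1 *\<^sub>R f' (a + t))) (at t)" for t
    by (rule vector_diff_chain_at) (auto intro!: derivative_eq_intros f'(1))
  then have "((\<lambda>t. f (a + t)) has_vector_derivative f' (a + t)) (at t)" for t
    by (simp add: o_def)
  then show ?case using Suc.IH[OF f'(2)]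
    unfolding Ck_on_reals.simps by (intro exI conjI allI)
qed

lemma cutoff_derivative_identity: "(k * (1 - 2 * r)) *\<^sub>R x + (r * (1 - r)) *\<^sub>R y
    = k *\<^sub>R (x + (-2) *\<^sub>R (r *\<^sub>R x)) + (r *\<^sub>R y + (-1) *\<^sub>R (r *\<^sub>R (r *\<^sub>R (y::'a::real_vector))))"
  by (simp add: algebra_simps)

text \<open>
  The normalised primitive of \<open>(r (1 - r))\<^sup>s\<close>. The exponent is chosen so that the derivative vanishes
  to order \<open>s\<close> at both ends of the unit interval.
\<close>

lemma cutoff_exists:
  obtains \<eta> :: "real \<Rightarrow> real" and c :: real where "\<eta> 0 = 0" "\<eta> 1 = 1"
    "\<And>r. r \<in> {0..1} \<Longrightarrow> 0 \<le> \<eta> r \<and> \<eta> r \<le> 1"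
    "\<And>r. r \<in> {0..1} \<Longrightarrow> (\<eta> has_real_derivative c * (r * (1 - r)) ^ s) (at r within {0..1})"
proof -
  define g where "g r = (r * (1 - r)) ^ s" for r :: real
  have gc: "continuous_on {0..1} g" unfolding g_def by (intro continuous_intros)
  have g0: "0 \<le> g r" if "r \<in> {0..1}" for r using that by (simp add: g_def)
  have gi: "g integrable_on {x..y}" if "{x..y} \<subseteq> {0..1}" for x y
    by (intro integrable_continuous_real continuous_on_subset[OF gc] that)
  define G where "G t = integral {0..t} g" for t
  have pos: "G 1 > 0"
  proof (rule ccontr)
    assume "\<not> G 1 > 0"
    moreover have "0 \<le> G 1" unfolding G_def by (rule integral_nonneg) (use gi g0 in auto)
    ultimately have "G 1 = 0" by simp
    moreover have "(g has_integral G 1) {0..1}" unfolding G_def by (intro integrable_integral gi) simp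
    ultimately have "(g has_integral 0) (cbox 0 1)" by simp
    then have "g (1/2) = 0"
      by (rule has_integral_0_cbox_imp_0[rotated 2]) (use gc g0 in auto)
    then show False by (simp add: g_def)
  qed
  have mono: "0 \<le> G r \<and> G r \<le> G 1" if r: "r \<in> {0..1}" for r
  proof
    show "0 \<le> G r" unfolding G_def by (rule integral_nonneg) (use gi g0 r in auto)
    have "0 \<le> integral {r..1} g" by (rule integral_nonneg) (use gi g0 r in auto)
    moreover have "G r + integral {r..1} g = G 1"
      unfolding G_def using r by (intro Henstock_Kurzweil_Integration.integral_combine gi) auto
    ultimately show "G r \<le> G 1" by linarith
  qed
  have der: "(G has_real_derivative g r) (at r within {0..1})" if "r \<in> {0..1}" for r
    unfolding G_def has_real_derivative_iff_has_vector_derivative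
    by (rule integral_has_vector_derivative[OF gc that])
  show thesis
  proof (rule that[of "\<lambda>t. G t / G 1" "1 / G 1"])
    show "G 0 / G 1 = 0" "G 1 / G 1 = 1" using pos by (simp_all add: G_def)
    fix r :: real assume r: "r \<in> {0..1}"
    show "0 \<le> G r / G 1 \<and> G r / G 1 \<le> 1" using mono[OF r] pos by simp
    show "((\<lambda>t. G t / G 1) has_real_derivative 1 / G 1 * (r * (1 - r)) ^ s) (at r within {0..1})"
      using DERIV_cdivide[OF der[OF r], of "G 1"] by (simp add: g_def)
  qed
qed

section \<open>Isometric groups with invertible generator\<close>

lemma has_vector_derivative_iff_quotient:
  fixes f :: "real \<Rightarrow> 'a::real_normed_vector"
  shows "(f has_vector_derivative d) (at x) \<longleftrightarrow> ((\<lambda>y. (f y - f x) /\<^sub>R (y - x)) \<longlongrightarrow> d) (at x)"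
proof -
  have eq: "norm (f y - f x - (y - x) *\<^sub>R d) / norm (y - x) = norm ((f y - f x) /\<^sub>R (y - x) - d)" if "y \<noteq> x" for y
  proof -
    have "(f y - f x) /\<^sub>R (y - x) - d = (f y - f x - (y - x) *\<^sub>R d) /\<^sub>R (y - x)"
      using that by (simp add: scaleR_diff_right)
    then show ?thesis by (simp add: divide_inverse_commute)
  qed
  have "(f has_vector_derivative d) (at x) \<longleftrightarrow>
     ((\<lambda>y. norm (f y - f x - (y - x) *\<^sub>R d) / norm (y - x)) \<longlongrightarrow> 0) (at x)"
    unfolding has_vector_derivative_def has_derivative_iff_norm
    by (simp add: bounded_linear_scaleR_left)
  also have "\<dots> \<longleftrightarrow> ((\<lambda>y. norm ((f y - f x) /\<^sub>R (y - x) - d)) \<longlongrightarrow> 0) (at x)"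
    by (rule Lim_cong_within) (use eq in auto)
  also have "\<dots> \<longleftrightarrow> ((\<lambda>y. (f y - f x) /\<^sub>R (y - x)) \<longlongrightarrow> d) (at x)"
    by (simp add: tendsto_norm_zero_iff LIM_zero_iff)
  finally show ?thesis .
qed

text \<open>
  A product rule for \<open>L s (G s)\<close> when \<open>L\<close> is only strongly continuous and the single orbit
  \<open>L s (G r)\<close> is differentiable. The uniform bound on the norms absorbs the remainder in \<open>G\<close>.
\<close>

lemma has_vector_derivative_contraction_family:
  fixes L :: "real \<Rightarrow> 'a::real_normed_vector \<Rightarrow> 'b::real_normed_vector"
  assumes lin: "\<And>s. linear (L s)" and bd: "\<And>s x. norm (L s x) \<le> norm x"
    and G: "(G has_vector_derivative g) (at r)"
    and d: "((\<lambda>s. L s (G r)) has_vector_derivative d) (at r)"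
    and c: "((\<lambda>s. L s g) \<longlongrightarrow> L r g) (at r)"
  shows "((\<lambda>s. L s (G s)) has_vector_derivative (d + L r g)) (at r)"
  unfolding has_vector_derivative_iff_quotient
proof -
  define q where "q s = (G s - G r) /\<^sub>R (s - r)" for s
  have q: "(q \<longlongrightarrow> g) (at r)" using G unfolding has_vector_derivative_iff_quotient q_def .
  have "((\<lambda>s. norm (q s - g)) \<longlongrightarrow> 0) (at r)"
    using q by (simp add: tendsto_norm_zero_iff LIM_zero_iff)
  then have "((\<lambda>s. L s (q s - g)) \<longlongrightarrow> 0) (at r)"
    by (rule Lim_null_comparison[rotated]) (simp add: bd)
  from tendsto_add[OF tendsto_add[OF d[unfolded has_vector_derivative_iff_quotient] c] this]
  have "((\<lambda>s. (L s (G r) - L r (G r)) /\<^sub>R (s - r) + L s g + L s (q s - g)) \<longlongrightarrow> d + L r g) (at r)"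
    by simp
  moreover have "(L s (G r) - L r (G r)) /\<^sub>R (s - r) + L s g + L s (q s - g)
      = (L s (G s) - L r (G r)) /\<^sub>R (s - r)" for s
    unfolding q_def
    by (simp add: linear_diff[OF lin] linear_scale[OF lin] linear_add[OF lin] scaleR_diff_right)
  ultimately show "((\<lambda>s. (L s (G s) - L r (G r)) /\<^sub>R (s - r)) \<longlongrightarrow> d + L r g) (at r)"
    by simp
qed

text \<open>
  The values of \<open>onorm\<close> make every \<open>T t\<close> a contraction; as its inverse \<open>T (- t)\<close> is one too, all
  \<open>T t\<close> are isometries.
\<close>

locale isometric_group =
  fixes D :: "'h::banach set" and A :: "'h \<Rightarrow> 'h" and T :: "real \<Rightarrow> 'h \<Rightarrow> 'h"
  assumes generates: "generates_C0_group D A T"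
    and onorm_T: "\<And>t. onorm (T t) = 1"
    and invertible: "boundedly_invertible_on D A"
begin

lemma bounded_linear_T: "bounded_linear (T t)"
  and T_zero: "T 0 x = x"
  and T_add: "T (s + t) x = T s (T t x)"
  and T_tendsto_0: "((\<lambda>t. T t x) \<longlongrightarrow> x) (at 0)"
  using generates by (simp_all add: generates_C0_group_def C0_group_def)

lemma linear_T: "linear (T t)"
  using bounded_linear_T by (rule bounded_linear.linear)

lemmas T_linear_simps =
  linear_add[OF linear_T] linear_diff[OF linear_T] linear_scale[OF linear_T] linear_0[OF linear_T] linear_neg[OF linear_T]

lemma norm_T: "norm (T t x) = norm x"
proof (rule antisym)
  have le: "norm (T s y) \<le> norm y" for s y
    using onorm[OF bounded_linear_T, of s y] by (simp add: onorm_T)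
  then show "norm (T t x) \<le> norm x" .
  have "norm (T (-t) (T t x)) \<le> norm (T t x)" by (rule le)
  then show "norm x \<le> norm (T t x)" by (simp add: T_add[symmetric] T_zero)
qed

lemma T_cancel: "T (- t) (T t x) = x" "T t (T (- t) x) = x"
  by (simp_all add: T_add[symmetric] T_zero)

lemma D_iff: "x \<in> D \<longleftrightarrow> (\<exists>y. ((\<lambda>t. (T t x - x) /\<^sub>R t) \<longlongrightarrow> y) (at 0))"
  and A_tendsto: "x \<in> D \<Longrightarrow> ((\<lambda>t. (T t x - x) /\<^sub>R t) \<longlongrightarrow> A x) (at 0)"
  using generates by (auto simp: generates_C0_group_def)

lemma A_eqI: "((\<lambda>t. (T t x - x) /\<^sub>R t) \<longlongrightarrow> y) (at 0) \<Longrightarrow> x \<in> D \<and> A x = y"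
  using D_iff A_tendsto tendsto_unique[OF trivial_limit_at] by metis

lemma T_in_D: "x \<in> D \<Longrightarrow> T t x \<in> D" and A_T: "x \<in> D \<Longrightarrow> A (T t x) = T t (A x)"
proof -
  have "T t x \<in> D \<and> A (T t x) = T t (A x)" if "x \<in> D"
  proof (rule A_eqI)
    have "((\<lambda>s. T t ((T s x - x) /\<^sub>R s)) \<longlongrightarrow> T t (A x)) (at 0)"
      by (rule bounded_linear.tendsto[OF bounded_linear_T A_tendsto[OF that]])
    moreover have "T t ((T s x - x) /\<^sub>R s) = (T s (T t x) - T t x) /\<^sub>R s" for s
      using T_add[of s t x] T_add[of t s x] by (simp add: T_linear_simps add.commute)
    ultimately show "((\<lambda>s. (T s (T t x) - T t x) /\<^sub>R s) \<longlongrightarrow> T t (A x)) (at 0)" by simp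
  qed
  then show "x \<in> D \<Longrightarrow> T t x \<in> D" "x \<in> D \<Longrightarrow> A (T t x) = T t (A x)" by auto
qed

lemma D_scale: "x \<in> D \<Longrightarrow> c *\<^sub>R x \<in> D \<and> A (c *\<^sub>R x) = c *\<^sub>R A x"
proof (rule A_eqI)
  assume "x \<in> D"
  from tendsto_scaleR[OF tendsto_const[of c] A_tendsto[OF this]]
  show "((\<lambda>t. (T t (c *\<^sub>R x) - c *\<^sub>R x) /\<^sub>R t) \<longlongrightarrow> c *\<^sub>R A x) (at 0)"
    by (simp add: T_linear_simps scaleR_diff_right mult.commute)
qed

definition Ainv :: "'h \<Rightarrow> 'h" where "Ainv = inv_into D A"

lemma bounded_linear_Ainv: "bounded_linear Ainv"
  and bij_A: "bij_betw A D UNIV"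
  using invertible by (simp_all add: boundedly_invertible_on_def Ainv_def)

lemma Ainv_in_D: "Ainv x \<in> D" and A_Ainv: "A (Ainv x) = x"
  using bij_A unfolding bij_betw_def Ainv_def by (auto intro: inv_into_into f_inv_into_f)

lemma Ainv_A: "x \<in> D \<Longrightarrow> Ainv (A x) = x"
  using bij_A unfolding bij_betw_def Ainv_def by (auto intro: inv_into_f_f)

lemma T_Ainv: "T t (Ainv x) = Ainv (T t x)"
  by (metis A_Ainv A_T Ainv_A Ainv_in_D T_in_D)

lemma T_tendsto:
  assumes F: "(F \<longlongrightarrow> y) (at s within S)"
  shows "((\<lambda>r. T (c - r) (F r)) \<longlongrightarrow> T (c - s) y) (at s within S)"
proof -
  have lim: "((\<lambda>t. T t x) \<longlongrightarrow> x) (nhds 0)" for x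
    using T_tendsto_0[of x] tendsto_at_iff_tendsto_nhds[of "\<lambda>t. T t x" 0] by (simp add: T_zero)
  have "((\<lambda>r. s - r) \<longlongrightarrow> s - s) (at s within S)" by (intro tendsto_intros)
  then have "((\<lambda>r. s - r) \<longlongrightarrow> 0) (at s within S)" by simp
  then have "((\<lambda>r. T (s - r) y) \<longlongrightarrow> y) (at s within S)"
    using filterlim_compose[OF lim] by blast
  then have "((\<lambda>r. T (c - s) (T (s - r) y)) \<longlongrightarrow> T (c - s) y) (at s within S)"
    by (rule bounded_linear.tendsto[OF bounded_linear_T])
  then have 1: "((\<lambda>r. T (c - r) y) \<longlongrightarrow> T (c - s) y) (at s within S)"
    by (simp add: T_add[symmetric])
  have "((\<lambda>r. norm (F r - y)) \<longlongrightarrow> 0) (at s within S)"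
    using F by (simp add: tendsto_norm_zero_iff LIM_zero_iff)
  then have "((\<lambda>r. T (c - r) (F r - y)) \<longlongrightarrow> 0) (at s within S)"
    by (rule Lim_null_comparison[rotated]) (simp add: norm_T)
  from tendsto_add[OF 1 this] show ?thesis by (simp add: T_linear_simps)
qed

lemma continuous_on_T: "continuous_on S F \<Longrightarrow> continuous_on S (\<lambda>r. T (c - r) (F r))"
  unfolding continuous_on_def by (intro ballI T_tendsto) auto

lemma T_has_vector_derivative:
  assumes "x \<in> D"
  shows "((\<lambda>s. T (c - s) x) has_vector_derivative - T (c - r) (A x)) (at r)"
  unfolding has_vector_derivative_iff_quotient
proof -
  have "((\<lambda>s. r - s) \<longlongrightarrow> r - r) (at r)" by (intro tendsto_intros)
  then have "filterlim (\<lambda>s. r - s) (at 0) (at r)"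
    by (simp add: filterlim_at eventually_at_filter)
  from filterlim_compose[OF A_tendsto[OF assms] this]
  have "((\<lambda>s. T (c - r) ((T (r - s) x - x) /\<^sub>R (r - s))) \<longlongrightarrow> T (c - r) (A x)) (at r)"
    by (rule bounded_linear.tendsto[OF bounded_linear_T])
  then have "((\<lambda>s. - T (c - r) ((T (r - s) x - x) /\<^sub>R (r - s))) \<longlongrightarrow> - T (c - r) (A x)) (at r)"
    by (rule tendsto_minus)
  moreover have "- T (c - r) ((T (r - s) x - x) /\<^sub>R (r - s)) = (T (c - s) x - T (c - r) x) /\<^sub>R (s - r)" for s
  proof -
    have "inverse (r - s) = - inverse (s - r)" by (metis inverse_minus_eq minus_diff_eq)
    then show ?thesis by (simp add: T_linear_simps T_add[symmetric])
  qed
  ultimately show "((\<lambda>s. (T (c - s) x - T (c - r) x) /\<^sub>R (s - r)) \<longlongrightarrow> - T (c - r) (A x)) (at r)" by simp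
qed

text \<open>
  Inserting \<open>Ainv\<close> puts \<open>F s\<close> into the domain of \<open>A\<close>, so the orbit can be differentiated although
  \<open>F s\<close> itself is an arbitrary vector.
\<close>

lemma T_Ainv_has_vector_derivative:
  assumes F: "(F has_vector_derivative F') (at r)"
  shows "((\<lambda>s. T (c - s) (Ainv (F s))) has_vector_derivative (Ainv (T (c - r) F') - T (c - r) (F r))) (at r)"
proof -
  have "((\<lambda>s. T (c - s) (Ainv (F s))) has_vector_derivative (- T (c - r) (A (Ainv (F r))) + T (c - r) (Ainv F'))) (at r)"
  proof (rule has_vector_derivative_contraction_family[where L = "\<lambda>s. T (c - s)" and G = "\<lambda>s. Ainv (F s)"])
    show "((\<lambda>s. Ainv (F s)) has_vector_derivative Ainv F') (at r)"
      by (rule bounded_linear.has_vector_derivative[OF bounded_linear_Ainv F])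
    show "((\<lambda>s. T (c - s) (Ainv (F r))) has_vector_derivative - T (c - r) (A (Ainv (F r)))) (at r)"
      by (rule T_has_vector_derivative[OF Ainv_in_D])
    show "((\<lambda>s. T (c - s) (Ainv F')) \<longlongrightarrow> T (c - r) (Ainv F')) (at r)"
      by (rule T_tendsto) simp
  qed (simp_all add: linear_T norm_T)
  then show ?thesis by (simp add: A_Ainv T_Ainv)
qed

text \<open>
  One integration by parts gains one power of \<open>Ainv\<close>, provided that \<open>F\<close> vanishes at the end points.
  The same identity with constant \<open>F\<close> produces steady states.
\<close>

lemma T_has_integral_by_parts:
  assumes F: "\<And>r. (F has_vector_derivative F' r) (at r)" and F': "continuous_on UNIV F'" and ab: "a \<le> b"
  shows "((\<lambda>r. T (c - r) (F r)) has_integral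
    (T (c - a) (Ainv (F a)) - T (c - b) (Ainv (F b)) + Ainv (integral {a..b} (\<lambda>r. T (c - r) (F' r))))) {a..b}"
proof -
  have 1: "((\<lambda>r. Ainv (T (c - r) (F' r)) - T (c - r) (F r)) has_integral
      (T (c - b) (Ainv (F b)) - T (c - a) (Ainv (F a)))) {a..b}"
    by (rule fundamental_theorem_of_calculus[OF ab])
       (rule has_vector_derivative_at_within, rule T_Ainv_has_vector_derivative[OF F])
  have 2: "((\<lambda>r. Ainv (T (c - r) (F' r))) has_integral Ainv (integral {a..b} (\<lambda>r. T (c - r) (F' r)))) {a..b}"
  proof -
    have "(\<lambda>r. T (c - r) (F' r)) integrable_on {a..b}"
      by (intro integrable_continuous_real continuous_on_T continuous_on_subset[OF F']) simp
    from has_integral_linear[OF integrable_integral[OF this] bounded_linear_Ainv]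
    show ?thesis by (simp add: o_def)
  qed
  have "((\<lambda>r. Ainv (T (c - r) (F' r)) - (Ainv (T (c - r) (F' r)) - T (c - r) (F r))) has_integral
      (Ainv (integral {a..b} (\<lambda>r. T (c - r) (F' r))) - (T (c - b) (Ainv (F b)) - T (c - a) (Ainv (F a))))) {a..b}"
    by (rule has_integral_diff[OF 2 1])
  then show ?thesis by (simp add: algebra_simps)
qed

text \<open>
  Since the weight vanishes at \<open>0\<close> and \<open>1\<close>, integration by parts exhibits the integral as \<open>Ainv\<close> of
  the integral with the derivative \<open>F'\<close> instead. The derivative is again a weight, of order
  one less, times a function that is one degree less smooth, so induction applies.
\<close>

lemma smoothing_in_dom_pow:
  assumes "Ck_on_reals s f"
  shows "integral {0..1} (\<lambda>r. T (c - r) ((r * (1 - r)) ^ s *\<^sub>R f r)) \<in> dom_pow D A s"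
  using assms
proof (induction s arbitrary: f)
  case 0
  then show ?case by simp
next
  case (Suc s)
  from Suc.prems obtain f' where f': "\<And>t. (f has_vector_derivative f' t) (at t)" "Ck_on_reals s f'"
    by auto
  have f: "Ck_on_reals s f" using Suc.prems by (rule Ck_on_reals_Suc_imp)
  \<comment> \<open>The cofactor of the weight \<open>(r (1 - r))\<^sup>s\<close> in the derivative of \<open>F\<close>, written with multiplications by
    \<open>r\<close> and by constants only, under which the class \<open>C\<^sup>s\<close> is stable.\<close>
  define g where "g r = real (Suc s) *\<^sub>R (f r + (-2) *\<^sub>R (r *\<^sub>R f r)) + (r *\<^sub>R f' r + (-1) *\<^sub>R (r *\<^sub>R (r *\<^sub>R f' r)))" for r
  have g: "Ck_on_reals s g"
    unfolding g_def by (intro Ck_on_reals_add Ck_on_reals_scale Ck_on_reals_scale_id f f'(2))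
  define F where "F r = (r * (1 - r)) ^ Suc s *\<^sub>R f r" for r
  define F' where "F' r = (r * (1 - r)) ^ s *\<^sub>R g r" for r
  have F: "(F has_vector_derivative F' r) (at r)" for r
  proof -
    have "((\<lambda>r. (r * (1 - r)) ^ Suc s) has_real_derivative (real (Suc s) * (r * (1 - r)) ^ s * (1 - 2 * r))) (at r)"
      by (auto intro!: derivative_eq_intros simp del: power_Suc)
    from has_vector_derivative_scaleR[OF this f'(1)[of r]]
    have "(F has_vector_derivative ((r * (1 - r)) ^ Suc s *\<^sub>R f' r + (real (Suc s) * (r * (1 - r)) ^ s * (1 - 2 * r)) *\<^sub>R f r)) (at r)"
      unfolding F_def .
    moreover have "(r * (1 - r)) ^ Suc s *\<^sub>R f' r + (real (Suc s) * (r * (1 - r)) ^ s * (1 - 2 * r)) *\<^sub>R f r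
        = (r * (1 - r)) ^ s *\<^sub>R ((real (Suc s) * (1 - 2 * r)) *\<^sub>R f r + (r * (1 - r)) *\<^sub>R f' r)"
      by (simp add: scaleR_add_right mult_ac)
    moreover have "(real (Suc s) * (1 - 2 * r)) *\<^sub>R f r + (r * (1 - r)) *\<^sub>R f' r = g r"
      unfolding g_def by (rule cutoff_derivative_identity)
    ultimately show ?thesis by (simp add: F'_def)
  qed
  have F'c: "continuous_on UNIV F'"
    unfolding F'_def using Ck_on_reals_imp_continuous[OF g] by (intro continuous_intros)
  have "integral {0..1} (\<lambda>r. T (c - r) (F r)) = Ainv (integral {0..1} (\<lambda>r. T (c - r) (F' r)))"
    using T_has_integral_by_parts[OF F F'c, of 0 1 c]
    by (simp add: F_def linear_0[OF bounded_linear.linear[OF bounded_linear_Ainv]] T_linear_simps integral_unique)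
  moreover have "integral {0..1} (\<lambda>r. T (c - r) (F' r)) \<in> dom_pow D A s"
    unfolding F'_def by (rule Suc.IH[OF g])
  ultimately show ?case
    unfolding F_def by (simp only: dom_pow.simps mem_Collect_eq Ainv_in_D A_Ainv simp_thms)
qed

lemma dom_pow_scale: "x \<in> dom_pow D A n \<Longrightarrow> c *\<^sub>R x \<in> dom_pow D A n"
  by (induction n arbitrary: x) (auto simp: D_scale)

lemma dom_pow_T: "x \<in> dom_pow D A n \<Longrightarrow> T t x \<in> dom_pow D A n"
  by (induction n arbitrary: x) (auto simp: T_in_D A_T)

lemma A_power_scale_T:
  "x \<in> dom_pow D A n \<Longrightarrow> i \<le> n \<Longrightarrow> (A ^^ i) (c *\<^sub>R T t x) = c *\<^sub>R T t ((A ^^ i) x)"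
proof (induction n arbitrary: x i)
  case (Suc n)
  show ?case
  proof (cases i)
    case (Suc m)
    have "x \<in> D" "A x \<in> dom_pow D A n" using Suc.prems by auto
    then show ?thesis
      using Suc.IH[of "A x" m] Suc.prems(2) \<open>i = Suc m\<close>
      by (simp add: funpow_Suc_right D_scale T_in_D A_T del: funpow.simps)
  qed simp
qed simp

lemma dom_pow_norm_scale_T:
  assumes "x \<in> dom_pow D A n"
  shows "dom_pow_norm A n (c *\<^sub>R T t x) = \<bar>c\<bar> * dom_pow_norm A n x"
proof -
  have "(\<Sum>i\<le>n. (norm ((A ^^ i) (c *\<^sub>R T t x)))\<^sup>2) = c\<^sup>2 * (\<Sum>i\<le>n. (norm ((A ^^ i) x))\<^sup>2)"
    using A_power_scale_T[OF assms] by (simp add: norm_T power_mult_distrib sum_distrib_left)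
  then show ?thesis by (simp add: dom_pow_norm_def real_sqrt_mult)
qed

end

section \<open>The extension to the extrapolation space\<close>

lemma dense_induct:
  assumes "closure (range \<iota>) = UNIV" and "closed {k. P k}" and "\<And>x. P (\<iota> x)"
  shows "P k"
proof -
  have "closure (range \<iota>) \<subseteq> {k. P k}"
    using assms(2,3) by (intro closure_minimal) auto
  then show ?thesis using assms(1) by auto
qed

text \<open>
  The estimate makes the map induced by \<open>L\<close> on the range of \<open>\<iota>\<close> well defined and uniformly continuous;
  it extends to the closure by completeness, and linearity and the bound pass to the limit.
\<close>

lemma bounded_linear_dense_extension:
  fixes \<iota> :: "'a::real_normed_vector \<Rightarrow> 'k::real_normed_vector" and L :: "'a \<Rightarrow> 'b::banach"
  assumes \<iota>: "linear \<iota>" and dense: "closure (range \<iota>) = UNIV"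
    and L: "linear L" and bd: "\<And>x. norm (L x) \<le> C * norm (\<iota> x)"
  obtains S where "bounded_linear S" "\<And>x. S (\<iota> x) = L x"
proof -
  define F where "F k = L (inv \<iota> k)" for k
  define C' where "C' = \<bar>C\<bar> + 1"
  have C': "C' > 0" by (simp add: C'_def)
  have bd': "norm (L x) \<le> C' * norm (\<iota> x)" for x
    using bd[of x] by (rule order_trans) (simp add: C'_def mult_right_mono)
  have F: "F (\<iota> x) = L x" for x
  proof -
    have "\<iota> (inv \<iota> (\<iota> x) - x) = 0"
      by (simp add: linear_diff[OF \<iota>] f_inv_into_f)
    then have "L (inv \<iota> (\<iota> x) - x) = 0" using bd'[of "inv \<iota> (\<iota> x) - x"] by simp
    then show ?thesis by (simp add: F_def linear_diff[OF L])
  qed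
  have "uniformly_continuous_on (range \<iota>) F"
    unfolding uniformly_continuous_on_def
  proof (intro allI impI)
    fix e :: real assume e: "e > 0"
    show "\<exists>d>0. \<forall>x\<in>range \<iota>. \<forall>x'\<in>range \<iota>. dist x' x < d \<longrightarrow> dist (F x') (F x) < e"
    proof (intro exI[of _ "e / C'"] conjI ballI impI)
      show "e / C' > 0" using e C' by simp
      fix k k' assume "k \<in> range \<iota>" "k' \<in> range \<iota>" and d: "dist k' k < e / C'"
      then obtain x x' where k: "k = \<iota> x" "k' = \<iota> x'" by auto
      have "dist (F k') (F k) = norm (L (x' - x))" by (simp add: k F dist_norm linear_diff[OF L])
      also have "\<dots> \<le> C' * norm (\<iota> (x' - x))" by (rule bd')
      also have "\<dots> = C' * dist k' k" by (simp add: k dist_norm linear_diff[OF \<iota>])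
      also have "\<dots> < e" using d C' by (simp add: field_simps)
      finally show "dist (F k') (F k) < e" .
    qed
  qed
  then obtain S where uc: "uniformly_continuous_on (closure (range \<iota>)) S"
    and S: "\<And>k. k \<in> range \<iota> \<Longrightarrow> F k = S k"
    by (rule uniformly_continuous_on_extension_on_closure) (rule that)
  have cont: "continuous_on UNIV S"
    using uniformly_continuous_imp_continuous[OF uc] dense by simp
  have cont': "continuous_on UNIV (\<lambda>x. S (g x))" if "continuous_on UNIV g" for g :: "'k \<Rightarrow> 'k"
    using continuous_on_compose2[OF cont that] by simp
  have S\<iota>: "S (\<iota> x) = L x" for x using S[of "\<iota> x"] F by simp
  have add1: "S (k + \<iota> x) = S k + S (\<iota> x)" for k x
  proof (rule dense_induct[OF dense, where P = "\<lambda>k. S (k + \<iota> x) = S k + S (\<iota> x)"])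
    show "closed {k. S (k + \<iota> x) = S k + S (\<iota> x)}"
      by (intro closed_Collect_eq cont' cont continuous_on_add continuous_on_id continuous_on_const)
    show "S (\<iota> y + \<iota> x) = S (\<iota> y) + S (\<iota> x)" for y
      by (simp add: linear_add[OF \<iota>, symmetric] S\<iota> linear_add[OF L])
  qed
  have add: "S (k + l) = S k + S l" for k l
  proof (rule dense_induct[OF dense, where P = "\<lambda>l. S (k + l) = S k + S l"])
    show "closed {l. S (k + l) = S k + S l}"
      by (intro closed_Collect_eq cont' cont continuous_on_add continuous_on_id continuous_on_const)
  qed (rule add1)
  have scale: "S (c *\<^sub>R k) = c *\<^sub>R S k" for c k
  proof (rule dense_induct[OF dense, where P = "\<lambda>k. S (c *\<^sub>R k) = c *\<^sub>R S k"])
    show "closed {k. S (c *\<^sub>R k) = c *\<^sub>R S k}"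
      by (intro closed_Collect_eq cont' cont continuous_on_scaleR continuous_on_id continuous_on_const)
    show "S (c *\<^sub>R \<iota> y) = c *\<^sub>R S (\<iota> y)" for y
      by (simp add: linear_scale[OF \<iota>, symmetric] S\<iota> linear_scale[OF L])
  qed
  have norm: "norm (S k) \<le> norm k * C'" for k
  proof (rule dense_induct[OF dense, where P = "\<lambda>k. norm (S k) \<le> norm k * C'"])
    show "closed {k. norm (S k) \<le> norm k * C'}"
      by (intro closed_Collect_le continuous_on_norm cont continuous_on_mult continuous_on_id continuous_on_const)
    show "norm (S (\<iota> y)) \<le> norm (\<iota> y) * C'" for y
      using bd'[of y] by (simp add: S\<iota> mult.commute)
  qed
  have "bounded_linear S" using add scale norm by (rule bounded_linear_intro)
  then show thesis using S\<iota> by (rule that)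
qed

lemma bounded_linear_eq_on_dense:
  assumes "closure (range \<iota>) = UNIV" and "bounded_linear F" "bounded_linear G"
    and "\<And>x. F (\<iota> x) = G (\<iota> x)"
  shows "F = G"
proof
  fix k
  show "F k = G k"
  proof (rule dense_induct[OF assms(1), where P = "\<lambda>k. F k = G k"])
    show "closed {k. F k = G k}"
      using assms(2,3) by (intro closed_Collect_eq linear_continuous_on)
  qed (rule assms(4))
qed

locale extrapolated_group = isometric_group D A T
  for D :: "'h::banach set" and A and T +
  fixes \<beta> :: real and \<iota> :: "'h \<Rightarrow> 'k::banach"
  assumes extrapolation: "extrapolation_space D A \<beta> \<iota>"
begin

definition R :: "'h \<Rightarrow> 'h" where "R = inv_into D (\<lambda>x. \<beta> *\<^sub>R x - A x)"

lemma linear_\<iota>: "linear \<iota>" and norm_\<iota>: "norm (\<iota> x) = norm (R x)"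
  and dense_\<iota>: "closure (range \<iota>) = UNIV" and bounded_linear_R: "bounded_linear R"
  and bij_R: "bij_betw (\<lambda>x. \<beta> *\<^sub>R x - A x) D UNIV"
  using extrapolation by (simp_all add: extrapolation_space_def boundedly_invertible_on_def R_def)

lemma R_in_D: "R x \<in> D" and resolvent_R: "\<beta> *\<^sub>R R x - A (R x) = x"
proof -
  have x: "x \<in> (\<lambda>x. \<beta> *\<^sub>R x - A x) ` D" using bij_R by (simp add: bij_betw_def)
  show "R x \<in> D" unfolding R_def by (rule inv_into_into[OF x])
  show "\<beta> *\<^sub>R R x - A (R x) = x" unfolding R_def by (rule f_inv_into_f[OF x])
qed

lemma R_resolvent: "x \<in> D \<Longrightarrow> R (\<beta> *\<^sub>R x - A x) = x"
  unfolding R_def by (rule inv_into_f_f[OF bij_betw_imp_inj_on[OF bij_R]])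

lemma R_T: "R (T t x) = T t (R x)"
proof -
  \<comment> \<open>The generator commutes with the group, so \<open>T t (R x)\<close> solves the resolvent equation of \<open>R (T t x)\<close>.\<close>
  have "\<beta> *\<^sub>R T t (R x) - A (T t (R x)) = T t (\<beta> *\<^sub>R R x - A (R x))"
    by (simp add: A_T[OF R_in_D] T_linear_simps)
  also have "\<dots> = T t x" by (simp add: resolvent_R)
  finally show ?thesis using R_resolvent[OF T_in_D[OF R_in_D[of x], of t]] by simp
qed

lemma bounded_linear_\<iota>: "bounded_linear \<iota>"
proof -
  obtain K where "\<forall>x. norm (R x) \<le> norm x * K"
    using bounded_linear.bounded[OF bounded_linear_R] ..
  then show ?thesis
    using linear_\<iota> by (intro bounded_linear_intro[of _ K]) (simp_all add: linear_add linear_scale norm_\<iota>)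
qed

lemma inj_\<iota>: "inj \<iota>"
proof (rule linear_injective_0[OF linear_\<iota>, THEN iffD2], intro allI impI)
  fix x :: 'h assume "\<iota> x = 0"
  then have "R x = 0" using norm_\<iota>[of x] by simp
  then have "x = \<beta> *\<^sub>R 0 - A 0" using resolvent_R[of x] by simp
  also have "A 0 = 0" using D_scale[OF R_in_D[of x], of 0] by simp
  finally show "x = 0" by simp
qed

lemmas \<iota>_linear_simps = linear_add[OF linear_\<iota>] linear_diff[OF linear_\<iota>] linear_scale[OF linear_\<iota>]
  linear_0[OF linear_\<iota>] linear_neg[OF linear_\<iota>]

lemma norm_\<iota>_T: "norm (\<iota> (T t x)) = norm (\<iota> x)"
  by (simp add: norm_\<iota> R_T norm_T)

abbreviation S :: "real \<Rightarrow> 'k \<Rightarrow> 'k" where "S t \<equiv> extend_op \<iota> (T t)"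

lemma bounded_linear_S: "bounded_linear (S t)" and S_\<iota>: "S t (\<iota> x) = \<iota> (T t x)"
proof -
  have lin: "linear (\<lambda>x. \<iota> (T t x))"
    using linear_compose[OF linear_T linear_\<iota>] by (simp add: o_def)
  have bd: "norm (\<iota> (T t x)) \<le> 1 * norm (\<iota> x)" for x by (simp add: norm_\<iota>_T)
  obtain S' where S': "bounded_linear S'" "\<And>x. S' (\<iota> x) = \<iota> (T t x)"
    using bounded_linear_dense_extension[OF linear_\<iota> dense_\<iota> lin bd] by blast
  define P where "P U \<longleftrightarrow> bounded_linear U \<and> (\<forall>x. U (\<iota> x) = \<iota> (T t x))" for U
  have "P (THE U. P U)"
  proof (rule theI[of P S'])
    show "P S'" using S' by (simp add: P_def)
    fix U assume "P U"
    then show "U = S'" using S'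
      by (intro bounded_linear_eq_on_dense[OF dense_\<iota>]) (simp_all add: P_def)
  qed
  then have "bounded_linear (S t) \<and> (\<forall>x. S t (\<iota> x) = \<iota> (T t x))"
    by (simp add: P_def extend_op_def)
  then show "bounded_linear (S t)" "S t (\<iota> x) = \<iota> (T t x)" by auto
qed

lemma linear_S: "linear (S t)"
  using bounded_linear_S by (rule bounded_linear.linear)

lemmas S_linear_simps = linear_add[OF linear_S] linear_diff[OF linear_S] linear_scale[OF linear_S]
  linear_0[OF linear_S] linear_neg[OF linear_S]

lemma S_add: "S (s + t) k = S s (S t k)"
proof -
  have "S (s + t) = (\<lambda>k. S s (S t k))"
    by (rule bounded_linear_eq_on_dense[OF dense_\<iota>])
       (simp_all add: bounded_linear_S bounded_linear_compose S_\<iota> T_add)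
  then show ?thesis by simp
qed

lemma S_zero: "S 0 k = k"
proof -
  have "S 0 = (\<lambda>k. k)"
    by (rule bounded_linear_eq_on_dense[OF dense_\<iota>]) (simp_all add: bounded_linear_S S_\<iota> T_zero)
  then show ?thesis by simp
qed

lemma norm_S: "norm (S t k) = norm k"
proof (rule dense_induct[OF dense_\<iota>, where P = "\<lambda>k. norm (S t k) = norm k"])
  show "closed {k. norm (S t k) = norm k}"
    by (intro closed_Collect_eq continuous_on_norm linear_continuous_on bounded_linear_S continuous_on_id)
qed (simp add: S_\<iota> norm_\<iota>_T)

text \<open>
  For vectors of \<open>H\<close> this is the strong continuity of \<open>T\<close>. The set of vectors with a continuous orbit
  is closed, because isometries turn convergence of vectors into uniform convergence of orbits.
\<close>

lemma continuous_on_S: "continuous_on X (\<lambda>r. S (c - r) k)"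
proof -
  define P where "P k \<longleftrightarrow> continuous_on UNIV (\<lambda>r. S (c - r) k)" for k
  have "P k"
  proof (rule dense_induct[OF dense_\<iota>, where P = P])
    show "P (\<iota> x)" for x
      unfolding P_def S_\<iota>
      by (intro bounded_linear.continuous_on[OF bounded_linear_\<iota>] continuous_on_T continuous_on_const)
    show "closed {k. P k}"
      unfolding closed_sequential_limits
    proof (intro allI impI, elim conjE)
      fix kn k assume kn: "\<forall>n. kn n \<in> {k. P k}" and lim: "kn \<longlonglongrightarrow> k"
      have "uniform_limit UNIV (\<lambda>n r. S (c - r) (kn n)) (\<lambda>r. S (c - r) k) sequentially"
      proof (rule uniform_limitI)
        fix e :: real assume "e > 0"
        with lim have "\<forall>\<^sub>F n in sequentially. dist (kn n) k < e" by (rule tendstoD)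
        then show "\<forall>\<^sub>F n in sequentially. \<forall>r\<in>UNIV. dist (S (c - r) (kn n)) (S (c - r) k) < e"
          by eventually_elim (simp add: dist_norm S_linear_simps(2)[symmetric] norm_S)
      qed
      moreover have "\<forall>\<^sub>F n in sequentially. continuous_on UNIV (\<lambda>r. S (c - r) (kn n))"
        using kn by (simp add: P_def)
      ultimately have "continuous_on UNIV (\<lambda>r. S (c - r) k)"
        using uniform_limit_theorem trivial_limit_sequentially by metis
      then show "k \<in> {k. P k}" by (simp add: P_def)
    qed
  qed
  then show ?thesis unfolding P_def by (rule continuous_on_subset) simp
qed

text \<open>
  The vector \<open>x\<close> is \<open>Q k\<close>, where \<open>Q\<close> is the bounded extension of \<open>Ainv\<close> to the extrapolation space. It
  exists because \<open>Ainv = \<beta> Ainv R - R\<close> by the resolvent identity, so that \<open>norm (Ainv x)\<close> is bounded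
  by a multiple of \<open>norm (R x) = norm (\<iota> x)\<close>. For \<open>k\<close> in \<open>H\<close> the formula is the fundamental theorem
  of calculus for \<open>T (\<tau> - r) (Ainv k)\<close>.
\<close>

lemma integral_S_const:
  obtains x where "\<And>\<tau>. 0 \<le> \<tau> \<Longrightarrow> integral {0..\<tau>} (\<lambda>r. S (\<tau> - r) k) = \<iota> (T \<tau> x - x)"
proof -
  have lin: "linear Ainv" using bounded_linear_Ainv by (rule bounded_linear.linear)
  obtain K where K: "\<forall>x. norm (Ainv x) \<le> norm x * K"
    using bounded_linear.bounded[OF bounded_linear_Ainv] ..
  have bd: "norm (Ainv x) \<le> (\<bar>\<beta>\<bar> * K + 1) * norm (\<iota> x)" for x
  proof -
    have "Ainv x = Ainv (\<beta> *\<^sub>R R x - A (R x))" by (simp add: resolvent_R)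
    also have "\<dots> = \<beta> *\<^sub>R Ainv (R x) - R x"
      by (simp add: linear_diff[OF lin] linear_scale[OF lin] Ainv_A[OF R_in_D])
    also have "norm \<dots> \<le> \<bar>\<beta>\<bar> * norm (Ainv (R x)) + norm (R x)"
      using norm_triangle_ineq4[of "\<beta> *\<^sub>R Ainv (R x)" "R x"] by simp
    also have "\<dots> \<le> \<bar>\<beta>\<bar> * (norm (R x) * K) + norm (R x)"
      using K by (intro add_right_mono mult_left_mono) auto
    finally show ?thesis by (simp add: norm_\<iota> algebra_simps)
  qed
  obtain Q where Q: "bounded_linear Q" "\<And>x. Q (\<iota> x) = Ainv x"
    using bounded_linear_dense_extension[OF linear_\<iota> dense_\<iota> lin bd] by blast
  have int: "(\<lambda>r. S (\<tau> - r) k) integrable_on {0..\<tau>}" for \<tau> k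
    by (rule integrable_continuous_real) (rule continuous_on_S)
  have "integral {0..\<tau>} (\<lambda>r. S (\<tau> - r) k) = \<iota> (T \<tau> (Q k) - Q k)" if \<tau>: "0 \<le> \<tau>" for \<tau> k
  proof -
    have "bounded_linear (\<lambda>k. integral {0..\<tau>} (\<lambda>r. S (\<tau> - r) k))"
    proof (rule bounded_linear_intro)
      show "integral {0..\<tau>} (\<lambda>r. S (\<tau> - r) (x + y)) =
        integral {0..\<tau>} (\<lambda>r. S (\<tau> - r) x) + integral {0..\<tau>} (\<lambda>r. S (\<tau> - r) y)" for x y
        by (simp add: S_linear_simps integral_add int)
      show "integral {0..\<tau>} (\<lambda>r. S (\<tau> - r) (c *\<^sub>R x)) = c *\<^sub>R integral {0..\<tau>} (\<lambda>r. S (\<tau> - r) x)" for c x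
        by (simp add: S_linear_simps)
      show "norm (integral {0..\<tau>} (\<lambda>r. S (\<tau> - r) x)) \<le> norm x * \<tau>" for x
        using integral_norm_bound_integral[OF int[of \<tau> x] integrable_const_ivl[of "norm x" 0 \<tau>]] \<tau>
        by (simp add: norm_S mult.commute)
    qed
    moreover have "bounded_linear (\<lambda>k. \<iota> (T \<tau> (Q k) - Q k))"
      by (intro bounded_linear_compose[OF bounded_linear_\<iota>] bounded_linear_sub
          bounded_linear_compose[OF bounded_linear_T] Q(1))
    moreover have "integral {0..\<tau>} (\<lambda>r. S (\<tau> - r) (\<iota> x)) = \<iota> (T \<tau> (Q (\<iota> x)) - Q (\<iota> x))" for x
    proof -
      have "((\<lambda>r. T (\<tau> - r) x) has_integral
         (T (\<tau> - 0) (Ainv x) - T (\<tau> - \<tau>) (Ainv x) + Ainv (integral {0..\<tau>} (\<lambda>r. T (\<tau> - r) 0)))) {0..\<tau>}"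
        by (rule T_has_integral_by_parts[where F = "\<lambda>_. x" and F' = "\<lambda>_. 0"]) (use \<tau> in auto)
      then have "((\<lambda>r. T (\<tau> - r) x) has_integral (T \<tau> (Ainv x) - Ainv x)) {0..\<tau>}"
        by (simp add: T_linear_simps linear_0[OF lin] T_zero)
      from integral_unique[OF has_integral_linear[OF this bounded_linear_\<iota>]]
      show ?thesis by (simp add: o_def S_\<iota> Q(2))
    qed
    ultimately have "(\<lambda>k. integral {0..\<tau>} (\<lambda>r. S (\<tau> - r) k)) = (\<lambda>k. \<iota> (T \<tau> (Q k) - Q k))"
      by (rule bounded_linear_eq_on_dense[OF dense_\<iota>])
    then show ?thesis by metis
  qed
  then show thesis using that by blast
qed

end

section \<open>The control system\<close>

locale control_group = extrapolated_group D A T \<beta> \<iota>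
  for D :: "'h::banach set" and A and T and \<beta> and \<iota> :: "'h \<Rightarrow> 'k::banach" +
  fixes B :: "'u::real_normed_vector \<Rightarrow> 'k"
  assumes bounded_linear_B: "bounded_linear B"
begin

lemma linear_B: "linear B"
  using bounded_linear_B by (rule bounded_linear.linear)

lemmas B_linear_simps = linear_add[OF linear_B] linear_diff[OF linear_B] linear_scale[OF linear_B]

abbreviation input :: "(real \<Rightarrow> 'u) \<Rightarrow> real \<Rightarrow> real \<Rightarrow> 'k" where
  "input \<equiv> input_integral \<iota> T B"

lemma B_bound:
  obtains M where "\<And>x. norm (B x) \<le> M * norm x"
proof -
  obtain K where "\<forall>x. norm (B x) \<le> norm x * K"
    using bounded_linear.bounded[OF bounded_linear_B] ..
  then show thesis by (intro that[of K]) (simp add: mult.commute)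
qed

lemma input_integrable:
  assumes u: "L2_on {a..b} u"
  shows "(\<lambda>r. S (c - r) (B (u r))) integrable_on {a..b}"
proof -
  obtain M where M: "\<And>x. norm (B x) \<le> M * norm x" by (rule B_bound) (rule that)
  show ?thesis
  proof (rule integrable_on_apply_strongly_measurable[where W = "\<lambda>r x. S (c - r) (B x)"])
    show "continuous_on {a..b} (\<lambda>r. S (c - r) (B x))" for x by (rule continuous_on_S)
    show "S (c - r) (B (x - y)) = S (c - r) (B x) - S (c - r) (B y)" for r x y
      by (simp add: S_linear_simps B_linear_simps)
    show "norm (S (c - r) (B x)) \<le> M * norm x" for r x by (simp add: norm_S M)
    show "strongly_measurable_on {a..b} u" using u by (simp add: L2_on_def)
    show "integrable (lebesgue_on {a..b}) (\<lambda>r. norm (u r))"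
      by (rule L2_on_imp_integrable_norm[OF _ u]) simp
  qed
qed

lemma input_add:
  assumes "L2_on {a..b} u" "L2_on {a..b} v"
  shows "input (\<lambda>r. u r + v r) a b = input u a b + input v a b"
  unfolding input_integral_def
  by (simp add: S_linear_simps B_linear_simps integral_add input_integrable[OF assms(1)] input_integrable[OF assms(2)])

lemma input_cong:
  assumes "\<And>r. a < r \<Longrightarrow> r < b \<Longrightarrow> u r = v r"
  shows "input u a b = input v a b"
  unfolding input_integral_def
  by (rule integral_spike[of "{a, b}"]) (use assms in auto)

text \<open>
  Moving the end point of the convolution outside of the integral turns inputs over different
  intervals into values of a single primitive.
\<close>

lemma input_eq_S_integral:
  assumes "L2_on {a..b} u"
  shows "input u a b = S (b - c) (integral {a..b} (\<lambda>r. S (c - r) (B (u r))))"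
proof -
  have "S (b - r) k = S (b - c) (S (c - r) k)" for r k
    by (simp add: S_add[symmetric])
  then show ?thesis
    using integral_linear[OF input_integrable[OF assms] bounded_linear_S, of "b - c" c]
    by (simp add: input_integral_def o_def)
qed

lemma input_shift: "input (\<lambda>r. u (r - c)) (a + c) (b + c) = input u a b"
  using integral_shift_Icc_real[of a b "\<lambda>r. S (b + c - r) (B (u (r - c)))" c]
  by (simp add: input_integral_def o_def add.commute[of c])

lemma input_split:
  assumes "a \<le> c" "c \<le> b" and u: "L2_on {a..b} u"
  shows "input u a b = S (b - c) (input u a c) + input u c b"
proof -
  have "L2_on {a..c} u" by (rule L2_on_subset[OF _ _ _ u]) (use assms in auto)
  from input_eq_S_integral[OF this, of b]
  have "S (b - c) (input u a c) = integral {a..c} (\<lambda>r. S (b - r) (B (u r)))"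
    by (simp add: S_add[symmetric] S_zero)
  then show ?thesis
    using Henstock_Kurzweil_Integration.integral_combine[OF assms(1,2) input_integrable[OF u, of b]]
    by (simp add: input_integral_def)
qed

definition steady_state :: "'u \<Rightarrow> 'h \<Rightarrow> bool" where
  "steady_state \<sigma> z \<longleftrightarrow> (\<forall>\<tau>\<ge>0. \<iota> z = \<iota> (T \<tau> z) + input (\<lambda>_. \<sigma>) 0 \<tau>)"

lemma steady_state_exists: "\<exists>z. steady_state \<sigma> z"
proof (rule integral_S_const[of "B \<sigma>"])
  fix x assume "\<And>\<tau>. 0 \<le> \<tau> \<Longrightarrow> integral {0..\<tau>} (\<lambda>r. S (\<tau> - r) (B \<sigma>)) = \<iota> (T \<tau> x - x)"
  then have "steady_state \<sigma> (- x)"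
    by (simp add: steady_state_def input_integral_def \<iota>_linear_simps T_linear_simps)
  then show ?thesis ..
qed

section \<open>Steering by controls with values in a set\<close>

text \<open>
  Only the values of the control on a compact interval matter, so that controls can be translated
  and concatenated; the identity is written in the extrapolation space, where the input is defined.
\<close>

definition steers :: "'u set \<Rightarrow> real \<Rightarrow> 'h \<Rightarrow> 'h \<Rightarrow> bool" where
  "steers P \<tau> x y \<longleftrightarrow> (\<exists>u. L2_on {0..\<tau>} u \<and> (AE t in lebesgue_on {0..\<tau>}. u t \<in> P) \<and>
     \<iota> y = \<iota> (T \<tau> x) + input u 0 \<tau>)"

lemma steersI:
  assumes "L2_on {0..\<tau>} u" "AE t in lebesgue_on {0..\<tau>}. u t \<in> P" "\<iota> y = \<iota> (T \<tau> x) + input u 0 \<tau>"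
  shows "steers P \<tau> x y"
  unfolding steers_def using assms by (intro exI[of _ u] conjI)

lemma steersE:
  assumes "steers P \<tau> x y"
  obtains u where "L2_on {0..\<tau>} u" "AE t in lebesgue_on {0..\<tau>}. u t \<in> P"
    "\<iota> y = \<iota> (T \<tau> x) + input u 0 \<tau>"
  using assms unfolding steers_def by (elim exE conjE) (rule that)

lemma steers_refl: "steers P 0 x x"
proof (rule steersI)
  show "L2_on {0..0::real} (\<lambda>_. 0::'u)" by (rule L2_on_const) (rule lmeasurable_interval)
  show "AE t in lebesgue_on {0..0::real}. (0::'u) \<in> P"
    by (rule AE_lebesgue_onI[of _ "{0}"]) auto
  show "\<iota> x = \<iota> (T 0 x) + input (\<lambda>_. 0) 0 0" by (simp add: input_integral_def T_zero)
qed

lemma steers_trans: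
  assumes 1: "steers P \<tau> x y" and 2: "steers P \<tau>' y z" and \<tau>: "0 \<le> \<tau>" "0 \<le> \<tau>'"
  shows "steers P (\<tau> + \<tau>') x z"
proof (rule steersE[OF 1], rule steersE[OF 2])
  fix u v
  assume u: "L2_on {0..\<tau>} u" "AE t in lebesgue_on {0..\<tau>}. u t \<in> P" "\<iota> y = \<iota> (T \<tau> x) + input u 0 \<tau>"
    and v: "L2_on {0..\<tau>'} v" "AE t in lebesgue_on {0..\<tau>'}. v t \<in> P" "\<iota> z = \<iota> (T \<tau>' y) + input v 0 \<tau>'"
  \<comment> \<open>The half-open interval makes the two pieces disjoint, so that the second one is exactly the
    translate of \<open>v\<close>.\<close>
  define w where "w r = (if r \<in> {0..<\<tau>} then u r else v (r - \<tau>))" for r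
  have Un: "{0..<\<tau>} \<union> {\<tau>..\<tau> + \<tau>'} = {0..\<tau> + \<tau>'}" using \<tau> by auto
  have S: "{0..<\<tau>} \<in> sets lebesgue" "{\<tau>..\<tau> + \<tau>'} \<in> sets lebesgue" "{0..\<tau>} \<in> sets lebesgue" by simp_all
  have u': "L2_on {0..<\<tau>} u"
    by (rule L2_on_subset[OF S(1,3) _ u(1)]) auto
  have v': "L2_on {\<tau>..\<tau> + \<tau>'} (\<lambda>r. v (r - \<tau>))"
    using L2_on_shift[OF v(1), of \<tau>] by (simp add: add.commute)
  have w: "L2_on {0..\<tau> + \<tau>'} w"
    using L2_on_If[OF S(1,2) u' v'] unfolding Un w_def .
  show ?thesis
  proof (rule steersI[OF w])
    have "AE t in lebesgue_on {0..<\<tau>}. w t \<in> P"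
    proof (rule AE_mp)
      show "AE t in lebesgue_on {0..<\<tau>}. u t \<in> P"
        by (rule AE_lebesgue_on_subset[OF S(1,3) _ u(2)]) auto
      show "AE t in lebesgue_on {0..<\<tau>}. u t \<in> P \<longrightarrow> w t \<in> P"
        by (rule AE_I2) (simp add: w_def)
    qed
    moreover have "AE t in lebesgue_on {\<tau>..\<tau> + \<tau>'}. w t \<in> P"
    proof -
      have "AE t in lebesgue_on {\<tau>..\<tau> + \<tau>'}. v (t - \<tau>) \<in> P"
        using AE_lebesgue_on_shift[OF v(2), of \<tau>] unfolding add_0 add.commute[of \<tau>' \<tau>] .
      then show ?thesis
        by (rule AE_mp) (rule AE_I2, simp add: w_def)
    qed
    ultimately show "AE t in lebesgue_on {0..\<tau> + \<tau>'}. w t \<in> P"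
      using AE_lebesgue_on_Un[OF S(1,2)] unfolding Un by blast
    have "input w 0 \<tau> = input u 0 \<tau>"
      by (rule input_cong) (simp add: w_def)
    moreover have "input w \<tau> (\<tau> + \<tau>') = input v 0 \<tau>'"
    proof -
      have "input w (0 + \<tau>) (\<tau>' + \<tau>) = input (\<lambda>r. v (r - \<tau>)) (0 + \<tau>) (\<tau>' + \<tau>)"
        by (rule input_cong) (simp add: w_def)
      then show ?thesis by (simp only: input_shift) (simp add: add.commute)
    qed
    ultimately have "input w 0 (\<tau> + \<tau>') = S \<tau>' (input u 0 \<tau>) + input v 0 \<tau>'"
      using input_split[OF \<tau>(1) _ w] \<tau>(2) by simp
    moreover have "input u 0 \<tau> = \<iota> (y - T \<tau> x)" using u(3) by (simp add: \<iota>_linear_simps)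
    ultimately have "input w 0 (\<tau> + \<tau>') = \<iota> (T \<tau>' (y - T \<tau> x)) + input v 0 \<tau>'"
      by (simp add: S_\<iota>)
    then have "input w 0 (\<tau> + \<tau>') = \<iota> (T \<tau>' y) - \<iota> (T (\<tau>' + \<tau>) x) + input v 0 \<tau>'"
      by (simp add: T_linear_simps \<iota>_linear_simps T_add)
    then show "\<iota> z = \<iota> (T (\<tau> + \<tau>') x) + input w 0 (\<tau> + \<tau>')"
      using v(3) by (simp add: add.commute)
  qed
qed

lemma steers_iterate:
  assumes \<tau>: "0 \<le> \<tau>" and step: "\<And>k. k < N \<Longrightarrow> steers P \<tau> (x k) (x (Suc k))"
  shows "steers P (real N * \<tau>) (x 0) (x N)"
  using step
proof (induction N)
  case 0
  then show ?case by (simp add: steers_refl)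
next
  case (Suc N)
  have "steers P (real N * \<tau> + \<tau>) (x 0) (x (Suc N))"
    by (rule steers_trans[OF Suc.IH Suc.prems]) (use \<tau> Suc.prems in auto)
  then show ?case by (simp add: algebra_simps)
qed

section \<open>Switching between a trajectory and a steady state\<close>

text \<open>
  Subtracting the steady state makes the convex combination of controls linear in
  \<open>b = u - \<sigma>\<close>: the control \<open>\<sigma> + \<eta> b\<close> contributes the input of \<open>\<eta> b\<close> only.
\<close>

lemma trajectory_minus_steady_state:
  assumes y: "mild_solution_on_reals \<iota> T B u y" and u: "L2_loc u" and z: "steady_state \<sigma> z" and t: "0 \<le> t"
  shows "\<iota> (y (a + t) - z) = \<iota> (T t (y a - z)) + input (\<lambda>r. u (a + r) - \<sigma>) 0 t"
proof -
  have "L2_on {a..a + t} u" using u by (simp add: L2_loc_def)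
  from L2_on_shift[OF this, of "- a"] have ua: "L2_on {0..t} (\<lambda>r. u (a + r))"
    by (simp add: add.commute)
  have "\<iota> (y (a + t)) = \<iota> (T t (y a)) + input u a (a + t)"
    using y[unfolded mild_solution_on_reals_def, rule_format, of a "a + t"] t by simp
  moreover have "input u a (a + t) = input (\<lambda>r. u (a + r)) 0 t"
    using input_shift[of u "- a" a "a + t"] by (simp add: add.commute)
  moreover have "input (\<lambda>r. u (a + r)) 0 t = input (\<lambda>r. u (a + r) - \<sigma>) 0 t + input (\<lambda>_. \<sigma>) 0 t"
    using input_add[of 0 t "\<lambda>r. u (a + r) - \<sigma>" "\<lambda>_. \<sigma>"] L2_on_const[of "{0..t}" \<sigma>]
      L2_on_diff_const[OF _ ua, of \<sigma>] by simp
  moreover have "input (\<lambda>_. \<sigma>) 0 t = \<iota> (z - T t z)"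
    using z t unfolding steady_state_def by (simp add: \<iota>_linear_simps)
  ultimately show ?thesis by (simp add: \<iota>_linear_simps T_linear_simps)
qed

text \<open>
  With \<open>q r = S (1 - r) (B (b r))\<close>, the hypothesis on \<open>f\<close> says that the primitive of \<open>q\<close> is
  \<open>T (1 - t) (f t) - T 1 (f 0)\<close>, a function with values in \<open>H\<close>. Integration by parts therefore moves
  the whole input of \<open>\<eta> b\<close> into \<open>H\<close>, at the price of a derivative on \<open>\<eta>\<close>.
\<close>

lemma cutoff_input:
  assumes b: "L2_on {0..1} b" and \<eta>b: "L2_on {0..1} (\<lambda>r. \<eta> r *\<^sub>R b r)"
    and f: "\<And>t. t \<in> {0..1} \<Longrightarrow> \<iota> (f t) = \<iota> (T t (f 0)) + input b 0 t" and fc: "continuous_on {0..1} f"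
    and \<eta>: "\<And>r. r \<in> {0..1} \<Longrightarrow> (\<eta> has_real_derivative \<psi> r) (at r within {0..1})"
    and \<psi>: "continuous_on {0..1} \<psi>"
  shows "input (\<lambda>r. \<eta> r *\<^sub>R b r) 0 1 =
    \<iota> (\<eta> 1 *\<^sub>R f 1 - \<eta> 0 *\<^sub>R T 1 (f 0) - integral {0..1} (\<lambda>r. T (1 - r) (\<psi> r *\<^sub>R f r)))"
proof -
  define q where "q r = S (1 - r) (B (b r))" for r
  define I where "I = integral {0..1} (\<lambda>r. T (1 - r) (\<psi> r *\<^sub>R f r))"
  obtain M where M: "\<And>x. norm (B x) \<le> M * norm x" by (rule B_bound) (rule that)
  have q: "q integrable_on {0..1}" unfolding q_def by (rule input_integrable[OF b])
  have \<eta>q_eq: "\<eta> r *\<^sub>R q r = S (1 - r) (B (\<eta> r *\<^sub>R b r))" for r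
    by (simp add: q_def S_linear_simps B_linear_simps)
  have \<eta>q: "(\<lambda>r. \<eta> r *\<^sub>R q r) integrable_on {0..1}"
    unfolding \<eta>q_eq by (rule input_integrable[OF \<eta>b])
  have "integrable (lebesgue_on {0..1}) (\<lambda>r. M * norm (b r))"
    by (intro integrable_mult_right L2_on_imp_integrable_norm b) simp
  then have m: "(\<lambda>r. M * norm (b r)) integrable_on {0..1}"
    by (rule integrable_on_lebesgue_on) simp
  have p: "integral {0..t} q = \<iota> (T (1 - t) (f t) - T 1 (f 0))" if t: "t \<in> {0..1}" for t
  proof -
    have "L2_on {0..t} b" by (rule L2_on_subset[OF _ _ _ b]) (use t in auto)
    from input_eq_S_integral[OF this, of 1]
    have "S (1 - t) (input b 0 t) = integral {0..t} q"
      by (simp add: q_def[abs_def] S_add[symmetric] S_zero)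
    moreover have "input b 0 t = \<iota> (f t - T t (f 0))"
      using f[OF t] by (simp add: \<iota>_linear_simps)
    ultimately show ?thesis
      by (simp add: S_\<iota> T_linear_simps T_add[symmetric])
  qed
  have \<psi>int: "(\<psi> has_integral (\<eta> 1 - \<eta> 0)) {0..1}"
    by (rule fundamental_theorem_of_calculus) (simp_all add: has_real_derivative_iff_has_vector_derivative[symmetric] \<eta>)
  have Ti: "(\<lambda>r. T (1 - r) (\<psi> r *\<^sub>R f r)) integrable_on {0..1}"
    by (intro integrable_continuous_real continuous_on_T continuous_on_scaleR \<psi> fc)
  have "((\<lambda>r. \<iota> (T (1 - r) (\<psi> r *\<^sub>R f r)) - \<psi> r *\<^sub>R \<iota> (T 1 (f 0))) has_integral
     (\<iota> I - (\<eta> 1 - \<eta> 0) *\<^sub>R \<iota> (T 1 (f 0)))) {0..1}"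
  proof (rule has_integral_diff)
    show "((\<lambda>r. \<iota> (T (1 - r) (\<psi> r *\<^sub>R f r))) has_integral \<iota> I) {0..1}"
      using has_integral_linear[OF integrable_integral[OF Ti] bounded_linear_\<iota>] by (simp add: o_def I_def)
    show "((\<lambda>r. \<psi> r *\<^sub>R \<iota> (T 1 (f 0))) has_integral (\<eta> 1 - \<eta> 0) *\<^sub>R \<iota> (T 1 (f 0))) {0..1}"
      using has_integral_linear[OF \<psi>int bounded_linear_scaleR_left[of "\<iota> (T 1 (f 0))"]] by (simp add: o_def)
  qed
  then have "((\<lambda>r. \<psi> r *\<^sub>R integral {0..r} q) has_integral (\<iota> I - (\<eta> 1 - \<eta> 0) *\<^sub>R \<iota> (T 1 (f 0)))) {0..1}"
    by (rule has_integral_eq[rotated]) (simp add: p \<iota>_linear_simps T_linear_simps scaleR_diff_right)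
  then have 2: "integral {0..1} (\<lambda>r. \<psi> r *\<^sub>R integral {0..r} q) = \<iota> I - (\<eta> 1 - \<eta> 0) *\<^sub>R \<iota> (T 1 (f 0))"
    by (rule integral_unique)
  have "integral {0..1} (\<lambda>r. \<eta> r *\<^sub>R q r)
    = \<eta> 1 *\<^sub>R integral {0..1} q - integral {0..1} (\<lambda>r. \<psi> r *\<^sub>R integral {0..r} q)"
  proof (rule integral_by_parts_L1[OF _ q m _ \<eta> \<psi> \<eta>q])
    show "norm (q r) \<le> M * norm (b r)" for r by (simp add: q_def norm_S M)
  qed simp_all
  also have "\<dots> = \<eta> 1 *\<^sub>R \<iota> (f 1 - T 1 (f 0)) - (\<iota> I - (\<eta> 1 - \<eta> 0) *\<^sub>R \<iota> (T 1 (f 0)))"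
    using p[of 1] by (simp add: 2 T_zero)
  also have "\<dots> = \<iota> (\<eta> 1 *\<^sub>R f 1 - \<eta> 0 *\<^sub>R T 1 (f 0) - I)"
    by (simp add: \<iota>_linear_simps algebra_simps)
  finally show ?thesis by (simp add: \<eta>q_eq input_integral_def I_def)
qed

lemma steers_along_cutoff:
  assumes y: "mild_solution_on_reals \<iota> T B u y" and u: "L2_loc u" and yc: "continuous_on UNIV y"
    and uP: "AE t in lebesgue. u t \<in> P" and P: "convex P" "\<sigma> \<in> P" and z: "steady_state \<sigma> z"
    and \<eta>: "\<And>r. r \<in> {0..1} \<Longrightarrow> (\<eta> has_real_derivative \<psi> r) (at r within {0..1})"
    and \<psi>: "continuous_on {0..1} \<psi>" and \<eta>01: "\<And>r. r \<in> {0..1} \<Longrightarrow> 0 \<le> \<eta> r \<and> \<eta> r \<le> 1"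
  shows "steers P 1 (z + x) (z + (T 1 x + (\<eta> 1 *\<^sub>R (y (a + 1) - z) - \<eta> 0 *\<^sub>R T 1 (y a - z)
    - integral {0..1} (\<lambda>r. T (1 - r) (\<psi> r *\<^sub>R (y (a + r) - z))))))"
proof -
  define b where "b r = u (a + r) - \<sigma>" for r
  define f where "f r = y (a + r) - z" for r
  have "L2_on {a..a + 1} u" using u by (simp add: L2_loc_def)
  from L2_on_shift[OF this, of "- a"] have ua: "L2_on {0..1} (\<lambda>r. u (a + r))"
    by (simp add: add.commute)
  have b: "L2_on {0..1} b" unfolding b_def by (rule L2_on_diff_const[OF _ ua]) (rule lmeasurable_interval)
  have \<eta>c: "continuous_on {0..1} \<eta>" using \<eta> by (intro DERIV_continuous_on) auto
  have \<eta>b: "L2_on {0..1} (\<lambda>r. \<eta> r *\<^sub>R b r)"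
  proof (rule L2_on_dominated[OF _ _ b, of _ 1])
    show "strongly_measurable_on {0..1} (\<lambda>r. \<eta> r *\<^sub>R b r)"
    proof (rule strongly_measurable_compose2[where g = "\<lambda>x y. x *\<^sub>R y"])
      show "strongly_measurable_on {0..1} \<eta>"
        by (rule continuous_imp_strongly_measurable_on[OF \<eta>c]) simp
      show "strongly_measurable_on {0..1} b" using b by (simp add: L2_on_def)
      show "continuous_on UNIV (\<lambda>p::real \<times> 'u. fst p *\<^sub>R snd p)"
        by (intro continuous_intros)
    qed
    have "norm (\<eta> r *\<^sub>R b r) \<le> 1 * (1 + norm (b r))" if "r \<in> {0..1}" for r
    proof -
      have "\<bar>\<eta> r\<bar> * norm (b r) \<le> 1 * norm (b r)" using \<eta>01[OF that] by (intro mult_right_mono) auto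
      then show ?thesis by simp
    qed
    then show "AE r in lebesgue_on {0..1}. norm (\<eta> r *\<^sub>R b r) \<le> 1 * (1 + norm (b r))"
      by (intro AE_I2) simp
  qed (rule lmeasurable_interval)
  have const: "L2_on {0..1::real} (\<lambda>_. \<sigma>)" by (rule L2_on_const) (rule lmeasurable_interval)
  have "\<iota> (f t) = \<iota> (T t (f 0)) + input b 0 t" if "t \<in> {0..1}" for t
    using trajectory_minus_steady_state[OF y u z, of t a] that by (simp add: f_def b_def[abs_def])
  moreover have "continuous_on {0..1} f"
  proof -
    have "continuous_on {0..1} (\<lambda>r. y (a + r))"
      by (rule continuous_on_compose2[OF yc]) (simp_all add: continuous_on_add)
    then show ?thesis unfolding f_def by (rule continuous_on_diff) simp
  qed
  ultimately have in\<eta>b: "input (\<lambda>r. \<eta> r *\<^sub>R b r) 0 1 =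
    \<iota> (\<eta> 1 *\<^sub>R f 1 - \<eta> 0 *\<^sub>R T 1 (f 0) - integral {0..1} (\<lambda>r. T (1 - r) (\<psi> r *\<^sub>R f r)))"
    using \<eta> \<psi> by (intro cutoff_input[OF b \<eta>b]) auto
  have "steers P 1 (z + x) (z + (T 1 x + (\<eta> 1 *\<^sub>R f 1 - \<eta> 0 *\<^sub>R T 1 (f 0)
    - integral {0..1} (\<lambda>r. T (1 - r) (\<psi> r *\<^sub>R f r)))))" (is "steers P 1 _ (z + (_ + ?e))")
  proof (rule steersI[of _ "\<lambda>r. \<sigma> + \<eta> r *\<^sub>R b r"])
    show "L2_on {0..1} (\<lambda>r. \<sigma> + \<eta> r *\<^sub>R b r)"
      using L2_on_diff_const[OF _ \<eta>b, of "- \<sigma>"] by (simp add: add.commute)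
    have "AE t in lebesgue_on UNIV. u t \<in> P" using uP unfolding lebesgue_on_UNIV_eq .
    then have "AE t in lebesgue_on {a..a + 1}. u t \<in> P"
      by (rule AE_lebesgue_on_subset[rotated 3]) auto
    moreover have "a + - a = 0" "a + 1 + - a = 1" "\<And>t. t - - a = a + t" by simp_all
    ultimately have "AE t in lebesgue_on {0..1}. u (a + t) \<in> P"
      using AE_lebesgue_on_shift[of "\<lambda>t. u t \<in> P" a "a + 1" "- a"] by (simp only:)
    then show "AE t in lebesgue_on {0..1}. \<sigma> + \<eta> t *\<^sub>R b t \<in> P"
    proof (rule AE_mp)
      have "\<sigma> + \<eta> t *\<^sub>R b t \<in> P" if "t \<in> {0..1}" "u (a + t) \<in> P" for t
      proof -
        have "(1 - \<eta> t) *\<^sub>R \<sigma> + \<eta> t *\<^sub>R u (a + t) \<in> P"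
          using \<eta>01[OF that(1)] that(2) P by (intro convexD) auto
        then show ?thesis by (simp add: b_def algebra_simps)
      qed
      then show "AE t in lebesgue_on {0..1}. u (a + t) \<in> P \<longrightarrow> \<sigma> + \<eta> t *\<^sub>R b t \<in> P"
        by (intro AE_I2) simp
    qed
    have "input (\<lambda>r. \<sigma> + \<eta> r *\<^sub>R b r) 0 1 = input (\<lambda>_. \<sigma>) 0 1 + \<iota> ?e"
      by (simp only: input_add[OF const \<eta>b] in\<eta>b)
    moreover have "\<iota> z = \<iota> (T 1 z) + input (\<lambda>_. \<sigma>) 0 1"
      using z by (simp add: steady_state_def)
    ultimately show "\<iota> (z + (T 1 x + ?e)) = \<iota> (T 1 (z + x)) + input (\<lambda>r. \<sigma> + \<eta> r *\<^sub>R b r) 0 1"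
      by (simp add: linear_add[OF linear_\<iota>] linear_add[OF linear_T])
  qed
  then show ?thesis by (simp add: f_def)
qed

lemma cutoff_correction_in_dom_pow:
  assumes "Ck_on_reals s y"
  shows "integral {0..1} (\<lambda>r. T (1 - r) ((c * (r * (1 - r)) ^ s) *\<^sub>R (y (a + r) - z))) \<in> dom_pow D A s"
proof -
  have "Ck_on_reals s (\<lambda>r. c *\<^sub>R (y (a + r) + (- z)))"
    by (rule Ck_on_reals_scale[OF Ck_on_reals_add[OF Ck_on_reals_shift[OF assms] Ck_on_reals_const]])
  from smoothing_in_dom_pow[OF this, of 1] show ?thesis by (simp add: mult.commute)
qed

text \<open>
  Fading out the trajectory, by \<open>1 - \<eta>\<close> in place of \<open>\<eta>\<close>, cancels the free evolution of the initial
  deviation \<open>y a - z\<close> and leaves only the smooth correction.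
\<close>

lemma trajectory_to_steady_state:
  assumes y: "mild_solution_on_reals \<iota> T B u y" "L2_loc u" and Ck: "Ck_on_reals s y"
    and P: "AE t in lebesgue. u t \<in> P" "convex P" "\<sigma> \<in> P" and z: "steady_state \<sigma> z"
  shows "\<exists>w \<in> dom_pow D A s. steers P 1 (y a) (z + w)"
proof (rule cutoff_exists[of s])
  fix \<eta> c
  assume \<eta>: "\<eta> 0 = 0" "\<eta> 1 = 1" "\<And>r. r \<in> {0..1} \<Longrightarrow> 0 \<le> \<eta> r \<and> \<eta> r \<le> 1"
    "\<And>r. r \<in> {0..1} \<Longrightarrow> (\<eta> has_real_derivative c * (r * (1 - r)) ^ s) (at r within {0..1})"
  define w where "w = integral {0..1} (\<lambda>r. T (1 - r) ((c * (r * (1 - r)) ^ s) *\<^sub>R (y (a + r) - z)))"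
  have "steers P 1 (z + (y a - z)) (z + (T 1 (y a - z) + ((1 - \<eta> 1) *\<^sub>R (y (a + 1) - z) - (1 - \<eta> 0) *\<^sub>R T 1 (y a - z)
    - integral {0..1} (\<lambda>r. T (1 - r) ((- (c * (r * (1 - r)) ^ s)) *\<^sub>R (y (a + r) - z))))))"
  proof (rule steers_along_cutoff[OF y Ck_on_reals_imp_continuous[OF Ck] P z])
    show "((\<lambda>r. 1 - \<eta> r) has_real_derivative - (c * (r * (1 - r)) ^ s)) (at r within {0..1})"
      if "r \<in> {0..1}" for r
      using DERIV_diff[OF DERIV_const \<eta>(4)[OF that], of 1] by simp
    show "continuous_on {0..1} (\<lambda>r. - (c * (r * (1 - r)) ^ s))" by (intro continuous_intros)
    show "0 \<le> 1 - \<eta> r \<and> 1 - \<eta> r \<le> 1" if "r \<in> {0..1}" for r using \<eta>(3)[OF that] by simp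
  qed
  then have "steers P 1 (y a) (z + w)"
    using \<eta>(1,2) by (simp add: w_def linear_neg[OF linear_T])
  moreover have "w \<in> dom_pow D A s" unfolding w_def by (rule cutoff_correction_in_dom_pow[OF Ck])
  ultimately show ?thesis by blast
qed

text \<open>
  Fading in the trajectory ends at \<open>y b\<close> up to the smooth correction \<open>J\<close>. The initial deviation is
  chosen to be \<open>J\<close> transported backwards by the group, so that its free evolution compensates \<open>J\<close>.
\<close>

lemma steady_state_to_trajectory:
  assumes y: "mild_solution_on_reals \<iota> T B u y" "L2_loc u" and Ck: "Ck_on_reals s y"
    and P: "AE t in lebesgue. u t \<in> P" "convex P" "\<sigma> \<in> P" and z: "steady_state \<sigma> z"
  shows "\<exists>w \<in> dom_pow D A s. steers P 1 (z + w) (y b)"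
proof (rule cutoff_exists[of s])
  fix \<eta> c
  assume \<eta>: "\<eta> 0 = 0" "\<eta> 1 = 1" "\<And>r. r \<in> {0..1} \<Longrightarrow> 0 \<le> \<eta> r \<and> \<eta> r \<le> 1"
    "\<And>r. r \<in> {0..1} \<Longrightarrow> (\<eta> has_real_derivative c * (r * (1 - r)) ^ s) (at r within {0..1})"
  define a where "a = b - 1"
  define J where "J = integral {0..1} (\<lambda>r. T (1 - r) ((c * (r * (1 - r)) ^ s) *\<^sub>R (y (a + r) - z)))"
  have "steers P 1 (z + T (- 1) J) (z + (T 1 (T (- 1) J) + (\<eta> 1 *\<^sub>R (y (a + 1) - z) - \<eta> 0 *\<^sub>R T 1 (y a - z)
    - integral {0..1} (\<lambda>r. T (1 - r) ((c * (r * (1 - r)) ^ s) *\<^sub>R (y (a + r) - z))))))"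
  proof (rule steers_along_cutoff[OF y Ck_on_reals_imp_continuous[OF Ck] P z \<eta>(4) _ \<eta>(3)])
    show "continuous_on {0..1} (\<lambda>r. c * (r * (1 - r)) ^ s)" by (intro continuous_intros)
  qed
  then have "steers P 1 (z + T (- 1) J) (y b)"
    unfolding J_def[symmetric] using \<eta>(1,2) by (simp add: T_cancel a_def)
  moreover have "T (- 1) J \<in> dom_pow D A s"
    unfolding J_def by (intro dom_pow_T cutoff_correction_in_dom_pow[OF Ck])
  ultimately show ?thesis by blast
qed

section \<open>Moving around a steady state by small controls\<close>

text \<open>
  A control that steers \<open>y\<close> to \<open>0\<close> produces the input \<open>- T T0 y\<close>. Hence a null control for
  \<open>y = - T (- T0) e\<close> produces the input \<open>e\<close>, and this does not depend on the deviation \<open>x\<close> to which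
  it is added. Admissibility is needed to read the value \<open>0\<close> of the state, which is defined through
  \<open>inv \<iota>\<close>, as an identity in the extrapolation space.
\<close>

lemma smooth_control_step:
  fixes j :: "'v::real_normed_vector \<Rightarrow> 'u"
  assumes adm: "admissible_control_operator \<iota> T B" and j: "bounded_linear j"
    and T0: "T0 > 0" and sc: "smoothly_controllable D A \<iota> T B j s T0"
    and \<epsilon>: "\<epsilon> > 0" "cball v0 \<epsilon> \<subseteq> j -` P" and z: "steady_state (j v0) z"
  shows "\<exists>\<delta>>0. \<forall>x e. e \<in> dom_pow D A s \<longrightarrow> dom_pow_norm A s e \<le> \<delta> \<longrightarrow>
    steers P T0 (z + x) (z + (T T0 x + e))"
proof -
  obtain C where C: "\<And>y. y \<in> dom_pow D A s \<Longrightarrow> \<exists>v. Linf_on {0<..<T0} v \<and>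
        mild_solution \<iota> T B y (\<lambda>t. j (v t)) T0 = 0 \<and>
        Linf_norm {0<..<T0} v \<le> C * dom_pow_norm A s y"
    using sc unfolding smoothly_controllable_def by blast
  define K where "K = \<bar>C\<bar> + 1"
  define \<delta> where "\<delta> = \<epsilon> / (2 * K)"
  have K: "K > 0" "\<bar>C\<bar> < K" using abs_ge_zero[of C] by (simp_all add: K_def)
  then have \<delta>: "\<delta> > 0" using \<epsilon>(1) by (simp add: \<delta>_def)
  have "steers P T0 (z + x) (z + (T T0 x + e))"
    if e: "e \<in> dom_pow D A s" "dom_pow_norm A s e \<le> \<delta>" for x e
  proof -
    have I: "{0<..<T0} \<in> sets lebesgue" "{0<..<T0} \<in> lmeasurable" "{0..T0} \<in> sets lebesgue"
      "{0<..} \<in> sets (lebesgue :: real measure)" by simp_all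
    define y where "y = (- 1) *\<^sub>R T (- T0) e"
    have "y \<in> dom_pow D A s" unfolding y_def by (intro dom_pow_scale dom_pow_T e)
    from C[OF this] obtain v where v: "Linf_on {0<..<T0} v"
        "mild_solution \<iota> T B y (\<lambda>t. j (v t)) T0 = 0"
        "Linf_norm {0<..<T0} v \<le> C * dom_pow_norm A s y" by blast
    have ny: "dom_pow_norm A s y = dom_pow_norm A s e"
      unfolding y_def dom_pow_norm_scale_T[OF e(1)] by simp
    have "C * dom_pow_norm A s y \<le> \<bar>C\<bar> * \<delta>"
    proof -
      have "0 \<le> dom_pow_norm A s e" by (simp add: dom_pow_norm_def sum_nonneg)
      then have "C * dom_pow_norm A s e \<le> \<bar>C\<bar> * dom_pow_norm A s e" by (intro mult_right_mono) auto
      also have "\<dots> \<le> \<bar>C\<bar> * \<delta>" using e(2) by (intro mult_left_mono) auto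
      finally show ?thesis unfolding ny .
    qed
    also have "\<dots> < \<epsilon>"
    proof -
      have "\<bar>C\<bar> * \<delta> < K * \<delta>" using K(2) \<delta> by (rule mult_strict_right_mono)
      also have "\<dots> = \<epsilon> / 2" using K(1) by (simp add: \<delta>_def)
      also have "\<dots> < \<epsilon>" using \<epsilon>(1) by simp
      finally show ?thesis .
    qed
    finally have "Linf_norm {0<..<T0} v < \<epsilon>" using v(3) by simp
    from Linf_norm_less_imp_AE[OF v(1) this]
    have vb: "AE r in lebesgue_on {0<..<T0}. norm (v r) \<le> \<epsilon>" .
    have vm: "strongly_measurable_on {0<..<T0} v" using v(1) by (simp add: Linf_on_def)
    have jv: "L2_on {0<..<T0} (\<lambda>r. j (v r))"
    proof -
      have "L2_on {0<..<T0} v" by (rule L2_on_bounded[OF I(2) vm vb])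
      obtain M where M: "\<forall>x. norm (j x) \<le> norm x * M"
        using bounded_linear.bounded[OF j] ..
      have M': "norm (j (v r)) \<le> \<bar>M\<bar> * (1 + norm (v r))" for r
      proof -
        have "norm (j (v r)) \<le> norm (v r) * M" using M by blast
        also have "\<dots> \<le> norm (v r) * \<bar>M\<bar>" by (intro mult_left_mono) auto
        also have "\<dots> \<le> (1 + norm (v r)) * \<bar>M\<bar>" by (intro mult_right_mono) auto
        finally show ?thesis by (simp add: mult.commute)
      qed
      show ?thesis
      proof (rule L2_on_dominated[OF I(2) _ \<open>L2_on {0<..<T0} v\<close>, of _ "\<bar>M\<bar>"])
        show "strongly_measurable_on {0<..<T0} (\<lambda>r. j (v r))"
          by (rule strongly_measurable_compose[OF vm]) (rule linear_continuous_on[OF j])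
        show "AE r in lebesgue_on {0<..<T0}. norm (j (v r)) \<le> \<bar>M\<bar> * (1 + norm (v r))"
          by (rule AE_I2) (rule M')
      qed
    qed
    \<comment> \<open>Admissibility speaks about controls on the half-line, so the control is extended by zero.\<close>
    define w where "w r = (if r \<in> {0<..<T0} then j (v r) else 0)" for r
    have w: "L2_on ({0<..<T0} \<union> X) w" if "X \<in> sets lebesgue" for X
      unfolding w_def
    proof (rule L2_on_If[OF I(1) that jv])
      show "L2_on X (\<lambda>_. 0)" by (simp add: L2_on_def strongly_measurable_const)
    qed
    have w1: "L2_on {0<..} w" using w[OF I(4)] by (simp add: Un_absorb1 greaterThanLessThan_def)
    have w2: "L2_on {0..T0} w"
    proof -
      have "{0<..<T0} \<union> {0..T0} = {0..T0}" by auto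
      then show ?thesis using w[OF I(3)] by simp
    qed
    have in_eq: "input (\<lambda>t. j (v t)) 0 T0 = input w 0 T0"
      by (rule input_cong) (simp add: w_def)
    have "input w 0 T0 \<in> range \<iota>"
      using adm T0 w1 unfolding admissible_control_operator_def by blast
    then obtain h where h: "input w 0 T0 = \<iota> h" by blast
    have "T T0 y + h = 0"
      using v(2) by (simp add: mild_solution_def in_eq h inv_f_f[OF inj_\<iota>])
    then have "h = e" by (simp add: y_def T_cancel T_linear_simps)
    have const: "L2_on {0..T0} (\<lambda>_. j v0)" by (rule L2_on_const) (rule lmeasurable_interval)
    show ?thesis
    proof (rule steersI[of _ "\<lambda>r. j v0 + w r"])
      show "L2_on {0..T0} (\<lambda>r. j v0 + w r)"
        using L2_on_diff_const[OF _ w2, of "- j v0"] by (simp add: add.commute)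
      have "AE t in lebesgue_on {0<..<T0}. j v0 + w t \<in> P"
        using vb
      proof (rule AE_mp)
        have "j v0 + w t \<in> P" if "t \<in> {0<..<T0}" "norm (v t) \<le> \<epsilon>" for t
        proof -
          have "v0 + v t \<in> cball v0 \<epsilon>" using that(2) by (simp add: dist_norm)
          then have "j (v0 + v t) \<in> P" using \<epsilon>(2) by blast
          then show ?thesis using that(1) by (simp add: w_def linear_add[OF bounded_linear.linear[OF j]])
        qed
        then show "AE t in lebesgue_on {0<..<T0}. norm (v t) \<le> \<epsilon> \<longrightarrow> j v0 + w t \<in> P"
          by (intro AE_I2) simp
      qed
      then show "AE t in lebesgue_on {0..T0}. j v0 + w t \<in> P"
      proof (rule AE_lebesgue_onE[OF I(1)])
        fix N assume N: "negligible N" "\<forall>t\<in>{0<..<T0} - N. j v0 + w t \<in> P"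
        show ?thesis
          by (rule AE_lebesgue_onI[OF I(3), of "N \<union> {0, T0}"]) (use N in auto)
      qed
      have "input (\<lambda>r. j v0 + w r) 0 T0 = input (\<lambda>_. j v0) 0 T0 + \<iota> e"
        by (simp only: input_add[OF const w2] h \<open>h = e\<close>)
      moreover have "\<iota> z = \<iota> (T T0 z) + input (\<lambda>_. j v0) 0 T0"
        using z T0 by (simp add: steady_state_def)
      ultimately show "\<iota> (z + (T T0 x + e)) = \<iota> (T T0 (z + x)) + input (\<lambda>r. j v0 + w r) 0 T0"
        by (simp add: linear_add[OF linear_\<iota>] linear_add[OF linear_T])
    qed
  qed
  then show ?thesis using \<delta> by blast
qed

text \<open>
  In step \<open>k\<close> the increment is \<open>\<gamma>\<close> times the vector \<open>h\<close> transported to time \<open>(k + 1) T0\<close>. Isometry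
  gives all these increments the same norm in \<open>D(A\<^sup>s)\<close>, so one bound on \<open>\<gamma>\<close> serves for every step,
  however many there are.
\<close>

lemma steers_small_steps:
  assumes step: "\<And>x e. e \<in> dom_pow D A s \<Longrightarrow> dom_pow_norm A s e \<le> \<delta> \<Longrightarrow>
      steers P T0 (z + x) (z + (T T0 x + e))"
    and T0: "0 \<le> T0" and h: "h \<in> dom_pow D A s" "\<bar>\<gamma>\<bar> * dom_pow_norm A s h \<le> \<delta>"
  shows "steers P (real N * T0) (z + \<alpha> *\<^sub>R h) (z + (\<alpha> + real N * \<gamma>) *\<^sub>R T (real N * T0) h)"
proof -
  define x where "x k = (\<alpha> + real k * \<gamma>) *\<^sub>R T (real k * T0) h" for k
  have "steers P T0 (z + x k) (z + x (Suc k))" for k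
  proof -
    have "steers P T0 (z + x k) (z + (T T0 (x k) + \<gamma> *\<^sub>R T (real (Suc k) * T0) h))"
      using h by (intro step) (simp_all add: dom_pow_scale dom_pow_T dom_pow_norm_scale_T)
    moreover have "T T0 (x k) + \<gamma> *\<^sub>R T (real (Suc k) * T0) h = x (Suc k)"
      by (simp add: x_def T_linear_simps T_add[symmetric] algebra_simps)
    ultimately show ?thesis by simp
  qed
  from steers_iterate[OF T0, where x = "\<lambda>k. z + x k" and N = N, OF this] show ?thesis by (simp add: x_def T_zero)
qed

text \<open>
  The deviation \<open>a\<close> is first removed in \<open>N\<close> portions. Then \<open>b\<close> is built up in \<open>M\<close> portions from its
  backward transport \<open>h\<close>, which the free evolution carries to \<open>b\<close>.
\<close>

lemma steers_around_steady_state: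
  assumes step: "\<And>x e. e \<in> dom_pow D A s \<Longrightarrow> dom_pow_norm A s e \<le> \<delta> \<Longrightarrow>
      steers P T0 (z + x) (z + (T T0 x + e))"
    and T0: "0 \<le> T0" and \<delta>: "\<delta> > 0" and a: "a \<in> dom_pow D A s" and b: "b \<in> dom_pow D A s"
  shows "\<exists>\<tau>\<ge>0. steers P \<tau> (z + a) (z + b)"
proof -
  have N_exists: "\<exists>N::nat. N > 0 \<and> 1 / real N * dom_pow_norm A s h \<le> \<delta>" for h
  proof -
    obtain N :: nat where "dom_pow_norm A s h / \<delta> < real N" using reals_Archimedean2 by blast
    then have N: "dom_pow_norm A s h < real (Suc N) * \<delta>"
      using \<delta> by (simp add: divide_less_eq algebra_simps)
    then show ?thesis by (intro exI[of _ "Suc N"] conjI) (simp_all add: divide_le_eq mult.commute)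
  qed
  obtain N where N: "N > 0" "1 / real N * dom_pow_norm A s a \<le> \<delta>" using N_exists by blast
  obtain M where M: "M > 0" "1 / real M * dom_pow_norm A s b \<le> \<delta>" using N_exists by blast
  have 1: "steers P (real N * T0) (z + a) z"
    using steers_small_steps[where \<gamma> = "- (1 / real N)" and N = N and \<alpha> = 1, OF step T0 a] N by simp
  define h where "h = T (- (real M * T0)) b"
  have h: "h \<in> dom_pow D A s" unfolding h_def by (rule dom_pow_T[OF b])
  have "dom_pow_norm A s h = dom_pow_norm A s b"
    using dom_pow_norm_scale_T[OF b, of 1] by (simp add: h_def)
  then have 2: "steers P (real M * T0) z (z + b)"
    using steers_small_steps[where \<gamma> = "1 / real M" and N = M and \<alpha> = 0, OF step T0 h] M by (simp add: h_def T_cancel)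
  have "steers P (real N * T0 + real M * T0) (z + a) (z + b)"
    by (rule steers_trans[OF 1 2]) (use T0 in simp_all)
  then show ?thesis using T0 by (intro exI[of _ "real N * T0 + real M * T0"]) simp
qed

section \<open>Steering from one trajectory to another\<close>

lemma steers_imp_mild_solution:
  assumes "steers P \<tau> x y"
  shows "\<exists>u. L2_on {0<..<\<tau>} u \<and> mild_solution \<iota> T B x u \<tau> = y \<and> (AE t in lebesgue_on {0<..<\<tau>}. u t \<in> P)"
proof (rule steersE[OF assms])
  fix u assume u: "L2_on {0..\<tau>} u" "AE t in lebesgue_on {0..\<tau>}. u t \<in> P" "\<iota> y = \<iota> (T \<tau> x) + input u 0 \<tau>"
  have I: "{0<..<\<tau>} \<in> sets lebesgue" "{0..\<tau>} \<in> sets lebesgue" "{0<..<\<tau>} \<subseteq> {0..\<tau>}" by auto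
  have "input u 0 \<tau> = \<iota> (y - T \<tau> x)" using u(3) by (simp add: \<iota>_linear_simps)
  then have "mild_solution \<iota> T B x u \<tau> = y"
    by (simp add: mild_solution_def inv_f_f[OF inj_\<iota>])
  then show ?thesis
    using L2_on_subset[OF I u(1)] AE_lebesgue_on_subset[OF I u(2)] by (intro exI[of _ u] conjI)
qed

end

theorem theorem2p6:
  fixes D :: "'h::{real_inner, banach} set"
    and A :: "'h \<Rightarrow> 'h"
    and T :: "real \<Rightarrow> 'h \<Rightarrow> 'h"
    and \<beta> :: real
    and \<iota> :: "'h \<Rightarrow> 'k::banach"
    and B :: "'u::{real_inner, banach} \<Rightarrow> 'k"
    and j :: "'v::{real_inner, banach} \<Rightarrow> 'u"
    and s :: nat
    and U\<^sub>a\<^sub>d :: "'u set"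
    and ybar :: "nat \<Rightarrow> real \<Rightarrow> 'h"
    and ubar :: "nat \<Rightarrow> real \<Rightarrow> 'u"
    and \<tau>\<^sub>0 \<tau>\<^sub>1 :: real
  assumes semigroup: "generates_C0_semigroup D A T"
    and H_minus_1: "extrapolation_space D A \<beta> \<iota>"
    and B_bounded: "bounded_linear B"
    and B_admissible: "admissible_control_operator \<iota> T B"
    and V_embedded: "bounded_linear j" "inj j"
    and H1: "\<exists>T\<^sub>0>0. smoothly_controllable D A \<iota> T B j s T\<^sub>0"
    and H2: "closed U\<^sub>a\<^sub>d" "convex U\<^sub>a\<^sub>d" "interior (j -` U\<^sub>a\<^sub>d) \<noteq> {}"
    and H3: "generates_C0_group D A T" "\<And>t. onorm (T t) = 1" "boundedly_invertible_on D A"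
    and ybar_smooth: "\<And>i. i \<in> {0, 1} \<Longrightarrow> Ck_on_reals s (ybar i)"
    and ybar_solution: "\<And>i. i \<in> {0, 1} \<Longrightarrow> mild_solution_on_reals \<iota> T B (ubar i) (ybar i)"
    and ubar_L2_loc: "\<And>i. i \<in> {0, 1} \<Longrightarrow> L2_loc (ubar i)"
    and ubar_admissible: "\<And>i. i \<in> {0, 1} \<Longrightarrow> AE t in lebesgue. ubar i t \<in> U\<^sub>a\<^sub>d"
  shows "\<exists>\<tau>>0. \<exists>u. L2_on {0<..<\<tau>} u \<and>
           mild_solution \<iota> T B (ybar 0 \<tau>\<^sub>0) u \<tau> = ybar 1 \<tau>\<^sub>1 \<and>
           (AE t in lebesgue_on {0<..<\<tau>}. u t \<in> U\<^sub>a\<^sub>d)"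
proof -
  interpret control_group D A T \<beta> \<iota> B
    by (intro control_group.intro extrapolated_group.intro isometric_group.intro
        extrapolated_group_axioms.intro control_group_axioms.intro H3 H_minus_1 B_bounded)
  obtain T\<^sub>0 where T0: "T\<^sub>0 > 0" and sc: "smoothly_controllable D A \<iota> T B j s T\<^sub>0"
    using H1 by blast
  obtain v\<^sub>0 \<epsilon> where \<epsilon>: "\<epsilon> > 0" "cball v\<^sub>0 \<epsilon> \<subseteq> j -` U\<^sub>a\<^sub>d"
    using H2(3) mem_interior_cball[of _ "j -` U\<^sub>a\<^sub>d"] by blast
  have \<sigma>: "j v\<^sub>0 \<in> U\<^sub>a\<^sub>d" using subsetD[OF \<epsilon>(2), of v\<^sub>0] \<epsilon>(1) by simp
  obtain z where z: "steady_state (j v\<^sub>0) z" using steady_state_exists by blast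
  obtain \<delta> where \<delta>: "\<delta> > 0" and step: "\<And>x e. e \<in> dom_pow D A s \<Longrightarrow> dom_pow_norm A s e \<le> \<delta> \<Longrightarrow>
      steers U\<^sub>a\<^sub>d T\<^sub>0 (z + x) (z + (T T\<^sub>0 x + e))"
    using smooth_control_step[OF B_admissible V_embedded(1) T0 sc \<epsilon> z] by blast
  obtain a where a: "a \<in> dom_pow D A s" "steers U\<^sub>a\<^sub>d 1 (ybar 0 \<tau>\<^sub>0) (z + a)"
    using trajectory_to_steady_state[OF ybar_solution ubar_L2_loc ybar_smooth ubar_admissible H2(2) \<sigma> z, of 0 \<tau>\<^sub>0] by auto
  obtain b where b: "b \<in> dom_pow D A s" "steers U\<^sub>a\<^sub>d 1 (z + b) (ybar 1 \<tau>\<^sub>1)"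
    using steady_state_to_trajectory[OF ybar_solution ubar_L2_loc ybar_smooth ubar_admissible H2(2) \<sigma> z, of 1 \<tau>\<^sub>1] by auto
  obtain \<tau> where \<tau>: "\<tau> \<ge> 0" "steers U\<^sub>a\<^sub>d \<tau> (z + a) (z + b)"
    using steers_around_steady_state[OF step less_imp_le[OF T0] \<delta> a(1) b(1)] by blast
  have "steers U\<^sub>a\<^sub>d (1 + \<tau>) (ybar 0 \<tau>\<^sub>0) (z + b)"
    by (rule steers_trans[OF a(2) \<tau>(2)]) (use \<tau> in simp_all)
  then have "steers U\<^sub>a\<^sub>d (1 + \<tau> + 1) (ybar 0 \<tau>\<^sub>0) (ybar 1 \<tau>\<^sub>1)"
    by (rule steers_trans[OF _ b(2)]) (use \<tau> in simp_all)
  from steers_imp_mild_solution[OF this] show ?thesis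
    using \<tau>(1) by (intro exI[of _ "1 + \<tau> + 1"] conjI) simp_all
qed

end
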